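(* Let $\mathbb{S}$ be any SIC set in $\mathbb{CP}^2$. Then $\mathbb{S}$ is congruent modulo $SU(3)$ to a midpoint solution; that is, there exists $X\in SU(3)$, acting on $\mathbb{CP}^2$ by $[\mathbf z]\mapsto[X\mathbf z]$, such that $X\cdot\mathbb{S}$ is a midpoint solution.
   Context: For $\mathbf z\in\mathbb C^3\setminus\{0\}$, $[\mathbf z]=[z_1,z_2,z_3]$ denotes the corresponding point of $\mathbb{CP}^2$, and $\langle\mathbf w,\mathbf z\rangle=\sum_i\overline{w_i}z_i$. A SIC set in $\mathbb{CP}^2$ is a set of nine distinct points $[\mathbf z_1],\dots,[\mathbf z_9]$, represented by unit vectors $\mathbf z_i$, which are mutually equidistant: $|\langle\mathbf z_i,\mathbf z_j\rangle|^2=\kappa$ for all $i\neq j$, for some fixed $\kappa\in[0,1)$ (necessarily $\kappa=1/4$). Let $$C_1=\{[0,z_2,z_3]:|z_2|=|z_3|\neq0\},\quad C_2=\{[z_1,0,z_3]:|z_1|=|z_3|\ne0\},\quad C_3=\{[z_1,z_2,0]:|z_1|=|z_2|\ne0\}.$$ A midpoint solution is a SIC set in $\mathbb{CP}^2$ consisting of three points in each of the three circles $C_1,C_2,C_3$. *)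

theory Defs
  imports "HOL-Analysis.Analysis"
begin

text \<open>A point of the projective plane is the punctured complex line through a representative,
  i.e. the class of a nonzero vector under multiplication by nonzero scalars.\<close>

definition proj_pt :: "complex^3 \<Rightarrow> (complex^3) set" where
  "proj_pt z = {c *s z | c. c \<noteq> 0}"

definition CP2 :: "(complex^3) set set" where
  "CP2 = proj_pt ` (UNIV - {0})"

lemma proj_pt_eq_iff: "proj_pt z = proj_pt w \<longleftrightarrow> (\<exists>c. c \<noteq> 0 \<and> w = c *s z)"
proof
  assume "proj_pt z = proj_pt w"
  moreover have "w \<in> proj_pt w"
    unfolding proj_pt_def by (auto intro!: exI[of _ 1])
  ultimately show "\<exists>c. c \<noteq> 0 \<and> w = c *s z"
    unfolding proj_pt_def by blast
next
  assume "\<exists>c. c \<noteq> 0 \<and> w = c *s z"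
  then obtain c where c: "c \<noteq> 0" "w = c *s z" by blast
  have "\<exists>d. d \<noteq> 0 \<and> b *s z = d *s w" if "b \<noteq> 0" for b
    using c that by (intro exI[of _ "b / c"]) (simp add: vector_smult_assoc)
  moreover have "\<exists>d. d \<noteq> 0 \<and> b *s w = d *s z" if "b \<noteq> 0" for b
    using c that by (intro exI[of _ "b * c"]) (simp add: vector_smult_assoc)
  ultimately show "proj_pt z = proj_pt w"
    unfolding proj_pt_def by blast
qed

text \<open>The Hermitian product is conjugate-linear in its first argument. The norm it induces is the
  library's Euclidean norm on \<^typ>\<open>complex^3\<close>.\<close>

definition herm :: "complex^3 \<Rightarrow> complex^3 \<Rightarrow> complex" where
  "herm w z = (\<Sum>i\<in>UNIV. cnj (w $ i) * z $ i)"

lemma herm_self: "herm z z = complex_of_real ((norm z)\<^sup>2)"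
proof -
  have "(norm z)\<^sup>2 = (\<Sum>i\<in>UNIV. (cmod (z $ i))\<^sup>2)"
    by (simp add: norm_vec_def L2_set_def sum_nonneg)
  moreover have "cnj a * a = complex_of_real ((cmod a)\<^sup>2)" for a
    using complex_norm_square[of a] by (simp add: mult.commute)
  ultimately show ?thesis
    by (simp add: herm_def)
qed

definition SIC_set :: "(complex^3) set set \<Rightarrow> bool" where
  "SIC_set S \<longleftrightarrow> S \<subseteq> CP2 \<and>
     (\<exists>(z :: nat \<Rightarrow> complex^3) (\<kappa> :: real).
        inj_on (\<lambda>i. proj_pt (z i)) {1..9} \<and>
        S = (\<lambda>i. proj_pt (z i)) ` {1..9} \<and>
        (\<forall>i\<in>{1..9}. norm (z i) = 1) \<and>
        0 \<le> \<kappa> \<and> \<kappa> < 1 \<and>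
        (\<forall>i\<in>{1..9}. \<forall>j\<in>{1..9}. i \<noteq> j \<longrightarrow> (cmod (herm (z i) (z j)))\<^sup>2 = \<kappa>))"

definition C1 :: "(complex^3) set set" where
  "C1 = {proj_pt (vector [0, z2, z3]) | z2 z3. cmod z2 = cmod z3 \<and> cmod z3 \<noteq> 0}"

definition C2 :: "(complex^3) set set" where
  "C2 = {proj_pt (vector [z1, 0, z3]) | z1 z3. cmod z1 = cmod z3 \<and> cmod z3 \<noteq> 0}"

definition C3 :: "(complex^3) set set" where
  "C3 = {proj_pt (vector [z1, z2, 0]) | z1 z2. cmod z1 = cmod z2 \<and> cmod z2 \<noteq> 0}"

definition midpoint_solution :: "(complex^3) set set \<Rightarrow> bool" where
  "midpoint_solution S \<longleftrightarrow> SIC_set S \<and> S \<subseteq> C1 \<union> C2 \<union> C3 \<and>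
     card (S \<inter> C1) = 3 \<and> card (S \<inter> C2) = 3 \<and> card (S \<inter> C3) = 3"

definition conj_transpose :: "complex^3^3 \<Rightarrow> complex^3^3" where
  "conj_transpose X = (\<chi> i j. cnj (X $ j $ i))"

definition SU3 :: "(complex^3^3) set" where
  "SU3 = {X. conj_transpose X ** X = mat 1 \<and> X ** conj_transpose X = mat 1 \<and> det X = 1}"

text \<open>A matrix acts on a projective point by mapping every representative; the lemma below recovers
  the usual description on homogeneous coordinates.\<close>

definition proj_act :: "complex^3^3 \<Rightarrow> (complex^3) set \<Rightarrow> (complex^3) set" where
  "proj_act X p = (\<lambda>v. X *v v) ` p"

lemma proj_act_proj_pt: "proj_act X (proj_pt z) = proj_pt (X *v z)"
proof -
  have scal: "X *v (c *s z) = c *s (X *v z)" for c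
    by (simp add: vector_scalar_commute)
  have pt: "proj_pt w = (\<lambda>c. c *s w) ` (UNIV - {0})" for w
    unfolding proj_pt_def by auto
  show ?thesis
    unfolding proj_act_def pt by (simp add: image_image scal)
qed

end

theory Submission
  imports Defs "HOL-Computational_Algebra.Polynomial"
begin

text \<open>
Ten cubic monomials against nine conditions: some nonzero cubic \<open>F\<close> vanishes on the SIC set. Since a
SIC set is a tight frame and a projective 2-design, the polar conic of \<open>F\<close> at each of the nine points
splits as the line orthogonal to that point times a tangent line. After moving two points to
\<open>(1, \<plusminus>\<i> sqrt 3, 0) / 2\<close>, this leaves only
\<open>F = c y (3 x\<^sup>2 + y\<^sup>2) + 3 s w (x\<^sup>2 - y\<^sup>2) + g w\<^sup>3\<close> with \<open>|g|\<^sup>2 = 2 |c|\<^sup>2\<close>,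
while each of the other seven points has the form \<open>[1, 0, 0]\<close> or \<open>[r, 1, sqrt 2 u]\<close> with \<open>r\<close> real and
\<open>|u| = 1\<close>. The equation \<open>F = 0\<close> together with its complex conjugate admits so few pairs \<open>(r, u)\<close>
that three of the nine points must be collinear.

Choosing the two points inside a collinear triple, the third point becomes \<open>[1, 0, 0]\<close> and
equidistance from it forces \<open>r = \<plusminus>1\<close> for the remaining six. The three lines \<open>w = 0\<close>, \<open>x = y\<close>,
\<open>x = -y\<close> are mutually orthogonal, and each contains at most three points.
\<close>

subsection \<open>Tight frame and design property\<close>

lemma cmod_eqI:
  assumes "a * cnj a = b * cnj b" shows "cmod a = cmod b"
proof -
  have "complex_of_real ((cmod a)\<^sup>2) = of_real ((cmod b)\<^sup>2)"
    using assms by (simp only: complex_norm_square)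
  hence "(cmod a)\<^sup>2 = (cmod b)\<^sup>2" by (simp only: of_real_eq_iff)
  thus ?thesis by simp
qed

lemma of_real_sqrt2_sq: "complex_of_real (sqrt 2) * complex_of_real (sqrt 2) = 2"
  by (simp only: of_real_mult[symmetric] real_sqrt_mult_self) simp

lemma i_sqrt3_sq: "\<i> * complex_of_real (sqrt 3) * (\<i> * complex_of_real (sqrt 3)) = - 3"
proof -
  have "\<i> * complex_of_real (sqrt 3) * (\<i> * complex_of_real (sqrt 3))
    = \<i> * \<i> * (complex_of_real (sqrt 3) * complex_of_real (sqrt 3))" by (simp only: mult_ac)
  thus ?thesis by (simp only: of_real_mult[symmetric] real_sqrt_mult_self) simp
qed

lemma herm_commute: "herm w z = cnj (herm z w)"
  by (simp add: herm_def mult.commute)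

text \<open>The Gram matrix of the nine rank-one projectors is (1 - \<kappa>) I + \<kappa> J with J
  the all-ones matrix. It is invertible, so the projectors form a basis of the nine-dimensional
  matrix space, and the formula expands the identity in this basis and its dual. Indexing the points
  by \<open>3 \<times> 3\<close> makes the matrix of projector entries square.\<close>

lemma projectors_dual:
  fixes z :: "3 \<times> 3 \<Rightarrow> complex^3" and \<kappa> :: real
  assumes unit: "\<And>k. herm (z k) (z k) = 1"
    and equi: "\<And>k l. k \<noteq> l \<Longrightarrow> herm (z k) (z l) * herm (z l) (z k) = of_real \<kappa>"
    and \<kappa>: "0 \<le> \<kappa>" "\<kappa> < 1"
  shows "(\<Sum>k\<in>UNIV. cnj (z k $ a) * z k $ b * z k $ c * cnj (z k $ d))
       = of_real (1 - \<kappa>) * (if a = c \<and> b = d then 1 else 0)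
         + of_real (\<kappa> / (1 + 8 * \<kappa>)) *
           (\<Sum>k\<in>UNIV. cnj (z k $ a) * z k $ b) * (\<Sum>k\<in>UNIV. cnj (z k $ d) * z k $ c)"
proof -
  define t :: complex where "t = of_real (\<kappa> / (1 + 8 * \<kappa>))"
  define e :: complex where "e = of_real (1 - \<kappa>)"
  have e0: "e \<noteq> 0" using \<kappa> unfolding e_def by (metis diff_gt_0_iff_gt less_irrefl of_real_eq_0_iff)
  have te: "t * (9 - 8 * e) = 1 - e"
  proof -
    have "1 + 8 * \<kappa> \<noteq> 0" using \<kappa> by linarith
    hence "\<kappa> / (1 + 8 * \<kappa>) * (9 - 8 * (1 - \<kappa>)) = 1 - (1 - \<kappa>)"
      by (simp add: field_simps)
    hence "complex_of_real (\<kappa> / (1 + 8 * \<kappa>) * (9 - 8 * (1 - \<kappa>))) = complex_of_real (1 - (1 - \<kappa>))"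
      by simp
    thus ?thesis unfolding t_def e_def by (simp only: of_real_mult of_real_diff of_real_1 of_real_numeral)
  qed
  define P where "P k p = z k $ fst p * cnj (z k $ snd p)" for k p
  \<comment> \<open>The inverse Gram matrix. As J J = 9 J, invertibility comes down to
    \<open>(1 - e) * (1 - 9 * t) = t * e\<close>, which fixes the value of \<open>t\<close>.\<close>
  define N where "N l k = ((if l = k then 1 else 0) - t) / e" for l k :: "3 \<times> 3"
  define A :: "complex^(3 \<times> 3)^(3 \<times> 3)" where "A = (\<chi> k p. P k p)"
  define B :: "complex^(3 \<times> 3)^(3 \<times> 3)" where "B = (\<chi> p k. \<Sum>l\<in>UNIV. cnj (P l p) * N l k)"
  have gram: "(\<Sum>p\<in>UNIV. P k p * cnj (P l p)) = (1 - e) + (if k = l then e else 0)" for k l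
  proof -
    have "(\<Sum>p\<in>UNIV. P k p * cnj (P l p)) = herm (z l) (z k) * herm (z k) (z l)"
      unfolding herm_def P_def sum_product
      by (simp add: sum.cartesian_product UNIV_Times_UNIV[symmetric] case_prod_beta mult_ac
          del: UNIV_Times_UNIV)
    also have "\<dots> = (1 - e) + (if k = l then e else 0)"
      using unit[of k] equi[of l k] unfolding e_def by auto
    finally show ?thesis .
  qed
  have "(A ** B) $ k $ m = mat 1 $ k $ m" for k m
  proof -
    have "(A ** B) $ k $ m = (\<Sum>p\<in>UNIV. \<Sum>l\<in>UNIV. P k p * cnj (P l p) * N l m)"
      unfolding A_def B_def matrix_matrix_mult_def by (simp add: sum_distrib_left mult.assoc)
    also have "\<dots> = (\<Sum>l\<in>UNIV. (\<Sum>p\<in>UNIV. P k p * cnj (P l p)) * N l m)"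
      by (subst sum.swap) (simp add: sum_distrib_right)
    also have "\<dots> = (1 - e) * (\<Sum>l\<in>UNIV. N l m) + e * N k m"
      unfolding gram by (simp add: ring_distribs sum.distrib sum_distrib_left if_distrib[of "\<lambda>x. x * _"] cong: if_cong)
    also have "(\<Sum>l\<in>UNIV. N l m) = (1 - 9 * t) / e"
      unfolding N_def by (simp add: sum_divide_distrib[symmetric] sum_subtractf)
    also have "(1 - e) * ((1 - 9 * t) / e) + e * N k m = (if k = m then 1 else 0)"
    proof -
      have "(1 - e) * (1 - 9 * t) = t * e" using te by algebra
      thus ?thesis using e0 unfolding N_def by (simp add: divide_eq_eq)
    qed
    finally show ?thesis by (simp add: mat_def)
  qed
  hence "A ** B = mat 1" by (simp add: vec_eq_iff)
  \<comment> \<open>Passing from a right to a left inverse turns relations summed over matrix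
    entries into relations summed over the nine points.\<close>
  hence "B ** A = mat 1" by (simp add: matrix_left_right_inverse)
  hence "(B ** A) $ (a, b) $ (c, d) = mat 1 $ (a, b) $ (c, d)" by simp
  hence "(\<Sum>k\<in>UNIV. (\<Sum>l\<in>UNIV. cnj (P l (a, b)) * N l k) * P k (c, d)) = (if a = c \<and> b = d then 1 else 0)"
    unfolding A_def B_def matrix_matrix_mult_def by (simp add: mat_def)
  moreover have "(\<Sum>l\<in>UNIV. cnj (P l (a, b)) * N l k)
      = (cnj (P k (a, b)) - t * (\<Sum>l\<in>UNIV. cnj (P l (a, b)))) / e" for k
    unfolding N_def by (simp add: sum_divide_distrib[symmetric] ring_distribs sum_subtractf sum_distrib_left mult_ac
        if_distrib[of "\<lambda>x. _ * x"] cong: if_cong)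
  ultimately have "(\<Sum>k\<in>UNIV. (cnj (P k (a, b)) - t * (\<Sum>l\<in>UNIV. cnj (P l (a, b)))) * P k (c, d))
      = e * (if a = c \<and> b = d then 1 else 0)"
    using e0 by (simp add: sum_divide_distrib[symmetric] divide_eq_eq mult_ac)
  hence "(\<Sum>k\<in>UNIV. cnj (P k (a, b)) * P k (c, d)) =
      e * (if a = c \<and> b = d then 1 else 0) + t * (\<Sum>l\<in>UNIV. cnj (P l (a, b))) * (\<Sum>k\<in>UNIV. P k (c, d))"
    by (simp only: left_diff_distrib sum_subtractf sum_distrib_left[symmetric]) (simp add: algebra_simps)
  thus ?thesis unfolding P_def t_def e_def by (simp add: mult_ac)
qed

lemma sum_cnj_mult: "(\<Sum>a\<in>UNIV. cnj (v $ a) * v $ a) = herm v v"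
  by (simp add: herm_def)

text \<open>Contracting \<open>projectors_dual\<close> over \<open>c = d\<close> gives S = (1 -
  \<kappa>) I + 9 t S for the frame operator S, since the vectors are unit. Hence S = (1 + 8
  \<kappa>) I, and trace 9 forces 1 + 8 \<kappa> = 3.\<close>

lemma equiangular_tight:
  fixes z :: "3 \<times> 3 \<Rightarrow> complex^3" and \<kappa> :: real
  assumes unit: "\<And>k. herm (z k) (z k) = 1"
    and equi: "\<And>k l. k \<noteq> l \<Longrightarrow> herm (z k) (z l) * herm (z l) (z k) = of_real \<kappa>"
    and \<kappa>: "0 \<le> \<kappa>" "\<kappa> < 1"
  shows "\<kappa> = 1 / 4" and "(\<Sum>k\<in>UNIV. cnj (z k $ a) * z k $ b) = (if a = b then 3 else 0)"
proof -
  define t where "t = \<kappa> / (1 + 8 * \<kappa>)"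
  have dual: "(\<Sum>k\<in>UNIV. cnj (z k $ a) * z k $ b * z k $ c * cnj (z k $ d))
       = of_real (1 - \<kappa>) * (if a = c \<and> b = d then 1 else 0)
         + of_real (\<kappa> / (1 + 8 * \<kappa>)) *
           (\<Sum>k\<in>UNIV. cnj (z k $ a) * z k $ b) * (\<Sum>k\<in>UNIV. cnj (z k $ d) * z k $ c)" for a b c d
    using unit equi \<kappa> by (rule projectors_dual)
  define S where "S a b = (\<Sum>k\<in>UNIV. cnj (z k $ a) * z k $ b)" for a b
  have pos: "1 + 8 * \<kappa> > 0" using \<kappa> by linarith
  have S9: "(\<Sum>c\<in>UNIV. S c c) = 9"
  proof -
    have "(\<Sum>c\<in>UNIV. S c c) = (\<Sum>k\<in>UNIV. \<Sum>c\<in>UNIV. cnj (z k $ c) * z k $ c)"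
      unfolding S_def by (rule sum.swap)
    thus ?thesis by (simp add: sum_cnj_mult unit)
  qed
  have S: "S a b = (if a = b then of_real (1 + 8 * \<kappa>) else 0)" for a b
  proof -
    have "(\<Sum>c\<in>UNIV. \<Sum>k\<in>UNIV. cnj (z k $ a) * z k $ b * z k $ c * cnj (z k $ c))
        = (\<Sum>c\<in>UNIV. of_real (1 - \<kappa>) * (if a = c \<and> b = c then 1 else 0) + of_real t * S a b * S c c)"
      unfolding dual t_def S_def ..
    also have "\<dots> = of_real (1 - \<kappa>) * (if a = b then 1 else 0) + of_real t * S a b * 9"
    proof -
      have "(\<Sum>c\<in>UNIV. if a = c \<and> b = c then 1 else 0) = (if a = b then 1 else 0 :: complex)"
        by (cases "a = b") (auto intro!: sum.neutral)
      thus ?thesis by (simp only: sum.distrib sum_distrib_left[symmetric] S9)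
    qed
    also have "(\<Sum>c\<in>UNIV. \<Sum>k\<in>UNIV. cnj (z k $ a) * z k $ b * z k $ c * cnj (z k $ c))
        = (\<Sum>k\<in>UNIV. cnj (z k $ a) * z k $ b * (\<Sum>c\<in>UNIV. cnj (z k $ c) * z k $ c))"
      by (subst sum.swap) (simp add: sum_distrib_left mult_ac)
    also have "\<dots> = S a b" by (simp add: sum_cnj_mult unit S_def)
    finally have "S a b * of_real (1 - 9 * t) = of_real (1 - \<kappa>) * (if a = b then 1 else 0)"
      by (simp add: algebra_simps)
    moreover have "1 - 9 * t = (1 - \<kappa>) / (1 + 8 * \<kappa>)"
      unfolding t_def using pos by (simp add: field_simps)
    moreover have "of_real (1 - \<kappa>) = of_real ((1 - \<kappa>) / (1 + 8 * \<kappa>)) * (of_real (1 + 8 * \<kappa>) :: complex)"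
      using pos unfolding of_real_mult[symmetric] by simp
    ultimately have "S a b * of_real (1 - \<kappa>) = of_real (1 - \<kappa>) * (if a = b then of_real (1 + 8 * \<kappa>) else 0)"
      by (simp only: mult.assoc[symmetric]) simp
    moreover have "of_real (1 - \<kappa>) \<noteq> (0 :: complex)" using \<kappa> by simp
    ultimately show ?thesis by (simp del: of_real_add of_real_diff)
  qed
  have "of_real (3 * (1 + 8 * \<kappa>)) = (of_real 9 :: complex)"
    using S9 unfolding S sum_3 by simp
  hence "3 * (1 + 8 * \<kappa>) = 9" by (simp only: of_real_eq_iff)
  thus "\<kappa> = 1 / 4" by simp
  hence "1 + 8 * \<kappa> = 3" by simp
  thus "(\<Sum>k\<in>UNIV. cnj (z k $ a) * z k $ b) = (if a = b then 3 else 0)"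
    using S[of a b] unfolding S_def by (simp only: of_real_numeral)
qed

locale sic =
  fixes z :: "3 \<times> 3 \<Rightarrow> complex^3"
  assumes unit: "herm (z k) (z k) = 1"
    and equi: "k \<noteq> l \<Longrightarrow> herm (z k) (z l) * herm (z l) (z k) = 1 / 4"
begin

lemma tight: "(\<Sum>k\<in>UNIV. cnj (z k $ a) * z k $ b) = (if a = b then 3 else 0)"
  by (rule equiangular_tight(2)[where \<kappa> = "1 / 4"]) (auto simp: unit equi)

text \<open>At \<kappa> = 1/4 the second term of \<open>projectors_dual\<close> has coefficient
  (1/12) * 3 * 3 = 3/4, equal to the first coefficient 1 - \<kappa>. The equality of the two
  coefficients is the 2-design property.\<close>

lemma design: "(\<Sum>k\<in>UNIV. cnj (z k $ a) * z k $ b * z k $ c * cnj (z k $ d))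
    = 3 / 4 * ((if a = c \<and> b = d then 1 else 0) + (if a = b \<and> c = d then 1 else 0))"
proof -
  show ?thesis
    using projectors_dual[of z "1 / 4" a b c d] by (simp add: unit equi tight)
qed

lemma tight_form:
  "(\<Sum>k\<in>UNIV. (\<Sum>c\<in>UNIV. f c * z k $ c) * cnj (\<Sum>c\<in>UNIV. g c * z k $ c)) = 3 * (\<Sum>c\<in>UNIV. f c * cnj (g c))"
proof -
  have "(\<Sum>k\<in>UNIV. (\<Sum>c\<in>UNIV. f c * z k $ c) * cnj (\<Sum>c\<in>UNIV. g c * z k $ c))
      = (\<Sum>k\<in>UNIV. \<Sum>c\<in>UNIV. \<Sum>d\<in>UNIV. f c * cnj (g d) * (cnj (z k $ d) * z k $ c))"
    by (simp add: sum_product mult_ac)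
  also have "\<dots> = (\<Sum>c\<in>UNIV. \<Sum>d\<in>UNIV. f c * cnj (g d) * (if d = c then 3 else 0))"
    by (subst sum.swap, subst sum.swap) (simp add: sum_distrib_left[symmetric] tight sum.swap[of _ UNIV "UNIV :: (3 \<times> 3) set"])
  finally show ?thesis by (simp add: sum_distrib_left mult_ac if_distrib[of "\<lambda>x. _ * x"] cong: if_cong)
qed

text \<open>For symmetric \<open>g\<close> the two delta terms of \<open>design\<close> contribute
  equally, which doubles 3/4 to 3/2.\<close>

lemma design_form:
  assumes sym: "\<And>a b. g a b = g b a"
  shows "(\<Sum>k\<in>UNIV. (\<Sum>a\<in>UNIV. \<Sum>b\<in>UNIV. f a b * z k $ a * z k $ b) *
      cnj (\<Sum>a\<in>UNIV. \<Sum>b\<in>UNIV. g a b * z k $ a * z k $ b))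
    = 3 / 2 * (\<Sum>a\<in>UNIV. \<Sum>b\<in>UNIV. f a b * cnj (g a b))"
proof -
  have "(\<Sum>k\<in>UNIV. (\<Sum>a\<in>UNIV. \<Sum>b\<in>UNIV. f a b * z k $ a * z k $ b) *
      cnj (\<Sum>c\<in>UNIV. \<Sum>d\<in>UNIV. g c d * z k $ c * z k $ d))
    = (\<Sum>k\<in>UNIV. \<Sum>a\<in>UNIV. \<Sum>b\<in>UNIV. \<Sum>c\<in>UNIV. \<Sum>d\<in>UNIV.
        f a b * cnj (g c d) * (cnj (z k $ c) * z k $ a * z k $ b * cnj (z k $ d)))"
    unfolding cnj_sum sum_distrib_right unfolding sum_distrib_left
    by (intro sum.cong refl) (simp add: mult_ac)
  also have "\<dots> = (\<Sum>a\<in>UNIV. \<Sum>b\<in>UNIV. \<Sum>c\<in>UNIV. \<Sum>d\<in>UNIV. f a b * cnj (g c d) *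
        (\<Sum>k\<in>UNIV. cnj (z k $ c) * z k $ a * z k $ b * cnj (z k $ d)))"
    unfolding sum.swap[of _ "UNIV :: 3 set" "UNIV :: (3 \<times> 3) set"] sum_distrib_left ..
  also have "\<dots> = (\<Sum>a\<in>UNIV. \<Sum>b\<in>UNIV. 3 / 4 * (f a b * cnj (g b a) + f a b * cnj (g a b)))"
  proof (intro sum.cong refl)
    fix a b :: 3
    have "(\<Sum>c\<in>UNIV. \<Sum>d\<in>UNIV. f a b * cnj (g c d) * (\<Sum>k\<in>UNIV. cnj (z k $ c) * z k $ a * z k $ b * cnj (z k $ d)))
      = (\<Sum>c\<in>UNIV. \<Sum>d\<in>UNIV. 3 / 4 * ((if c = b then if d = a then f a b * cnj (g c d) else 0 else 0) +
           (if c = a then if d = b then f a b * cnj (g c d) else 0 else 0)))"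
      unfolding design by (intro sum.cong refl) auto
    also have "\<dots> = 3 / 4 * (f a b * cnj (g b a) + f a b * cnj (g a b))"
    proof -
      have delta: "(\<Sum>d\<in>UNIV. if Q then if d = y then h d else 0 else 0) = (if Q then h y else 0)"
        for Q and y :: 3 and h :: "3 \<Rightarrow> complex" by simp
      show ?thesis unfolding sum.distrib sum_distrib_left[symmetric] delta by simp
    qed
    finally show "(\<Sum>c\<in>UNIV. \<Sum>d\<in>UNIV. f a b * cnj (g c d) * (\<Sum>k\<in>UNIV. cnj (z k $ c) * z k $ a * z k $ b * cnj (z k $ d)))
      = 3 / 4 * (f a b * cnj (g b a) + f a b * cnj (g a b))" .
  qed
  also have "\<dots> = 3 / 2 * (\<Sum>a\<in>UNIV. \<Sum>b\<in>UNIV. f a b * cnj (g a b))"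
    unfolding sum_distrib_left by (intro sum.cong refl) (simp add: sym[of _ _] field_simps sym)
  finally show ?thesis .
qed

end

subsection \<open>Cubics through a SIC set\<close>

text \<open>A cubic form is encoded by its polar form, a symmetric tensor.\<close>

definition cubic_tensor :: "(3 \<Rightarrow> 3 \<Rightarrow> 3 \<Rightarrow> complex) \<Rightarrow> bool" where
  "cubic_tensor F \<longleftrightarrow> (\<forall>a b c. F a b c = F b a c \<and> F a b c = F a c b)"

text \<open>The digit counts the free indices: \<open>polar2 F x\<close> is the polar conic at
  \<open>x\<close>, and \<open>polar1 F x\<close> is the polar line, which is the tangent at a
  smooth point of the cubic.\<close>

definition polar2 :: "(3 \<Rightarrow> 3 \<Rightarrow> 3 \<Rightarrow> complex) \<Rightarrow> complex^3 \<Rightarrow> 3 \<Rightarrow> 3 \<Rightarrow> complex" where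
  "polar2 F x a b = (\<Sum>c\<in>UNIV. F a b c * x $ c)"

definition polar1 :: "(3 \<Rightarrow> 3 \<Rightarrow> 3 \<Rightarrow> complex) \<Rightarrow> complex^3 \<Rightarrow> 3 \<Rightarrow> complex" where
  "polar1 F x b = (\<Sum>a\<in>UNIV. polar2 F x a b * x $ a)"

definition cubic :: "(3 \<Rightarrow> 3 \<Rightarrow> 3 \<Rightarrow> complex) \<Rightarrow> complex^3 \<Rightarrow> complex" where
  "cubic F x = (\<Sum>b\<in>UNIV. polar1 F x b * x $ b)"

lemma UNIV_prod_3: "(UNIV :: (3 \<times> 3) set) = UNIV \<times> UNIV" by simp

text \<open>The ten cubic monomials are \<open>x a\<^sup>2 * x b\<close>, indexed by \<open>Some (a, b)\<close>, and \<open>x 1 * x 2 * x 3\<close>,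
  indexed by \<open>None\<close>.\<close>

lemma exists_cubic_through:
  fixes z :: "3 \<times> 3 \<Rightarrow> complex^3"
  obtains F where "cubic_tensor F" "\<And>k. cubic F (z k) = 0" "\<exists>a b c. F a b c \<noteq> 0"
proof -
  define m where "m x p = (case p of None \<Rightarrow> x $ 1 * x $ 2 * x $ 3 | Some (a, b) \<Rightarrow> (x $ a)\<^sup>2 * x $ b)"
    for x :: "complex^3" and p :: "(3 \<times> 3) option"
  \<comment> \<open>Nine evaluation rows and one zero row make a square singular matrix; a kernel
    vector is the coefficient vector of a cubic through the points.\<close>
  define A :: "complex^((3 \<times> 3) option)^((3 \<times> 3) option)" where
    "A = (\<chi> q p. case q of None \<Rightarrow> 0 | Some k \<Rightarrow> m (z k) p)"
  have "\<not> (\<exists>B. A ** B = mat 1)"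
  proof
    assume "\<exists>B. A ** B = mat 1"
    then obtain B where "A ** B = mat 1" by blast
    hence "(A ** B) $ None $ None = 1" by (simp add: mat_def)
    thus False by (simp add: A_def matrix_matrix_mult_def)
  qed
  hence "\<not> (\<exists>B. B ** A = mat 1)" by (simp add: matrix_left_right_inverse)
  then obtain C where C: "A *v C = 0" "C \<noteq> 0" unfolding matrix_left_invertible_ker by blast
  define C0 where "C0 = C $ None"
  define G where "G a b = C $ Some (a, b)" for a b
  \<comment> \<open>Coefficients are divided by the number of orderings of the monomial: 1 for a
    cube, 3 for a square times another variable, 6 for the product of all three.\<close>
  define F where "F a b c = (if a = b then (if b = c then G a a else G a c / 3)
      else if b = c then G b a / 3 else if a = c then G a b / 3 else C0 / 6)" for a b c :: 3
  have "F a b c = F b a c" for a b c unfolding F_def by simp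
  moreover have "F a b c = F a c b" for a b c unfolding F_def by simp
  ultimately have ct: "cubic_tensor F" unfolding cubic_tensor_def by blast
  have "cubic F (z k) = (A *v C) $ Some k" for k
  proof -
    have "(A *v C) $ Some k = (\<Sum>p\<in>UNIV. m (z k) p * C $ p)"
      by (simp add: A_def matrix_vector_mult_def)
    also have "\<dots> = z k $ 1 * z k $ 2 * z k $ 3 * C0 + (\<Sum>a\<in>UNIV. \<Sum>b\<in>UNIV. (z k $ a)\<^sup>2 * z k $ b * G a b)"
      by (simp add: UNIV_option_conv sum.insert sum.reindex m_def C0_def G_def sum.cartesian_product
          case_prod_beta UNIV_prod_3 del: UNIV_Times_UNIV)
    also have "\<dots> = cubic F (z k)"
      unfolding cubic_def polar1_def polar2_def
      by (simp add: sum_3 F_def power2_eq_square algebra_simps)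
    finally show ?thesis ..
  qed
  hence "cubic F (z k) = 0" for k using C(1) by simp
  moreover have "\<exists>a b c. F a b c \<noteq> 0"
  proof (rule ccontr)
    assume "\<not> ?thesis"
    hence F0: "F a b c = 0" for a b c by blast
    have "C $ p = 0" for p
    proof (cases p)
      case None
      thus ?thesis using F0[of 1 2 3] by (simp add: F_def C0_def)
    next
      case (Some q)
      have "G a b = 0" for a b
        using F0[of a a b] unfolding F_def by (cases "a = b") auto
      thus ?thesis using Some by (cases q) (simp add: G_def)
    qed
    thus False using C(2) by (simp add: vec_eq_iff)
  qed
  ultimately show ?thesis using ct that by blast
qed

section \<open>Flexes of cubics vanishing on a SIC set\<close>

context sic begin

definition vanishing :: "(3 \<Rightarrow> 3 \<Rightarrow> 3 \<Rightarrow> complex) \<Rightarrow> bool" where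
  "vanishing F \<longleftrightarrow> cubic_tensor F \<and> (\<forall>k. cubic F (z k) = 0)"

lemma vanishing_sym:
  assumes "vanishing F"
  shows "F a b c = F b a c" "F a b c = F a c b"
  using assms by (simp_all add: vanishing_def cubic_tensor_def)

lemma vanishing_point:
  assumes "vanishing F"
  shows "(\<Sum>b\<in>UNIV. polar1 F (z k) b * z k $ b) = 0"
  using assms unfolding vanishing_def cubic_def by blast

lemma sum_norm_eq_0D:
  assumes "(\<Sum>k\<in>UNIV. \<Sum>a\<in>UNIV. \<Sum>b\<in>UNIV. q k a b * cnj (q k a b)) = (0 :: complex)"
  shows "q (k :: 3 \<times> 3) (a :: 3) (b :: 3) = 0"
proof -
  have "of_real (\<Sum>k\<in>UNIV. \<Sum>a\<in>UNIV. \<Sum>b\<in>UNIV. (cmod (q k a b))\<^sup>2) = (0 :: complex)"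
    using assms by (simp add: complex_norm_square[symmetric] del: of_real_power)
  hence "(\<Sum>k\<in>UNIV. \<Sum>a\<in>UNIV. \<Sum>b\<in>UNIV. (cmod (q k a b))\<^sup>2) = 0" by (simp only: of_real_eq_0_iff)
  thus ?thesis by (cases k) (simp add: sum_nonneg_eq_0_iff sum_nonneg)
qed

text \<open>Every point is a flex: its polar conic splits off the line orthogonal to it. The reason is that
  the defects \<open>q k\<close> have total squared norm \<open>3 * N - 2 * (3 / 2) * N = 0\<close>, where \<open>N\<close> is the squared
  norm of the tensor; the two terms are evaluated by tightness and by the design property.\<close>

lemma flex:
  assumes F: "vanishing F"
  shows "polar2 F (z k) a b = cnj (z k $ a) * polar1 F (z k) b + cnj (z k $ b) * polar1 F (z k) a"
proof -
  note sym = vanishing_sym[OF F]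
  have p2sym: "polar2 F x a b = polar2 F x b a" for x a b
    unfolding polar2_def using sym(1) by metis
  define P where "P k = polar2 F (z k)" for k
  define l where "l k = polar1 F (z k)" for k
  define N where "N = (\<Sum>a\<in>UNIV. \<Sum>b\<in>UNIV. \<Sum>c\<in>UNIV. F a b c * cnj (F a b c))"
  define q where "q k a b = P k a b - cnj (z k $ a) * l k b - cnj (z k $ b) * l k a" for k a b
  have Psym: "P k a b = P k b a" for k a b unfolding P_def by (rule p2sym)
  have lP: "(\<Sum>a\<in>UNIV. P k a b * z k $ a) = l k b" for k b
    unfolding l_def P_def polar1_def ..
  have l0: "(\<Sum>b\<in>UNIV. l k b * z k $ b) = 0" for k
    unfolding l_def by (rule vanishing_point[OF F])
  have zz: "(\<Sum>a\<in>UNIV. z k $ a * cnj (z k $ a)) = 1" for k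
    using unit[of k] by (simp add: herm_def mult.commute)
  have SP: "(\<Sum>k\<in>UNIV. \<Sum>a\<in>UNIV. \<Sum>b\<in>UNIV. P k a b * cnj (P k a b)) = 3 * N"
  proof -
    have "(\<Sum>k\<in>UNIV. \<Sum>a\<in>UNIV. \<Sum>b\<in>UNIV. P k a b * cnj (P k a b))
        = (\<Sum>a\<in>UNIV. \<Sum>b\<in>UNIV. \<Sum>k\<in>UNIV. P k a b * cnj (P k a b))"
      unfolding sum.swap[of _ "UNIV :: 3 set" "UNIV :: (3 \<times> 3) set"] ..
    also have "\<dots> = 3 * N"
      unfolding P_def polar2_def tight_form N_def sum_distrib_left ..
    finally show ?thesis .
  qed
  \<comment> \<open>Component \<open>b\<close> of the polar line is a quadratic form in the point
    with symmetric matrix \<open>F b\<close>, so \<open>design_form\<close> applies.\<close>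
  have Sl: "(\<Sum>k\<in>UNIV. \<Sum>b\<in>UNIV. l k b * cnj (l k b)) = 3 / 2 * N"
  proof -
    have l_eq: "l k b = (\<Sum>a\<in>UNIV. \<Sum>c\<in>UNIV. F b a c * z k $ a * z k $ c)" for k b
      unfolding l_def polar1_def polar2_def sum_distrib_right
      by (intro sum.cong refl) (simp add: sym(1)[of _ b] mult_ac)
    have "(\<Sum>k\<in>UNIV. \<Sum>b\<in>UNIV. l k b * cnj (l k b)) = (\<Sum>b\<in>UNIV. \<Sum>k\<in>UNIV. l k b * cnj (l k b))"
      by (rule sum.swap)
    also have "\<dots> = 3 / 2 * N"
      unfolding l_eq N_def sum_distrib_left[of "3 / 2" _ UNIV]
      by (subst design_form) (auto simp: sym(2) sum_distrib_left)
    finally show ?thesis .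
  qed
  have "(\<Sum>a\<in>UNIV. \<Sum>b\<in>UNIV. q k a b * cnj (q k a b))
      = (\<Sum>a\<in>UNIV. \<Sum>b\<in>UNIV. P k a b * cnj (P k a b)) - 2 * (\<Sum>b\<in>UNIV. l k b * cnj (l k b))" for k
  proof -
    have eq1: "(\<Sum>a\<in>UNIV. \<Sum>b\<in>UNIV. P k a b * (z k $ a * cnj (l k b))) = (\<Sum>b\<in>UNIV. l k b * cnj (l k b))"
      by (subst sum.swap) (simp add: lP[symmetric] sum_distrib_right mult_ac)
    have eq2: "(\<Sum>a\<in>UNIV. \<Sum>b\<in>UNIV. P k a b * (z k $ b * cnj (l k a))) = (\<Sum>b\<in>UNIV. l k b * cnj (l k b))"
      using eq1 by (subst sum.swap) (simp add: Psym)
    have eq3: "(\<Sum>a\<in>UNIV. \<Sum>b\<in>UNIV. cnj (z k $ a) * l k b * (z k $ a * cnj (l k b))) = (\<Sum>b\<in>UNIV. l k b * cnj (l k b))"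
    proof -
      have "(\<Sum>a\<in>UNIV. \<Sum>b\<in>UNIV. cnj (z k $ a) * l k b * (z k $ a * cnj (l k b)))
         = (\<Sum>a\<in>UNIV. z k $ a * cnj (z k $ a)) * (\<Sum>b\<in>UNIV. l k b * cnj (l k b))"
        unfolding sum_product by (intro sum.cong refl) (simp add: mult_ac)
      thus ?thesis by (simp add: zz)
    qed
    have eq4: "(\<Sum>a\<in>UNIV. \<Sum>b\<in>UNIV. cnj (z k $ a) * l k b * (z k $ b * cnj (l k a))) = 0"
    proof -
      have "(\<Sum>a\<in>UNIV. \<Sum>b\<in>UNIV. cnj (z k $ a) * l k b * (z k $ b * cnj (l k a)))
         = (\<Sum>a\<in>UNIV. cnj (z k $ a) * cnj (l k a)) * (\<Sum>b\<in>UNIV. l k b * z k $ b)"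
        unfolding sum_product by (intro sum.cong refl) (simp add: mult_ac)
      thus ?thesis by (simp add: l0)
    qed
    \<comment> \<open>The defect is P minus X minus the transpose of X. X and its transpose are
      orthogonal because the polar line passes through the point. All other products with X have the
      same value \<open>L\<close>, so the squared norm is that of P minus 4 L plus 2 L.\<close>
    define X where "X a b = cnj (z k $ a) * l k b" for a b
    have X: "(\<Sum>a\<in>UNIV. \<Sum>b\<in>UNIV. P k a b * cnj (X a b)) = (\<Sum>b\<in>UNIV. l k b * cnj (l k b))"
       "(\<Sum>a\<in>UNIV. \<Sum>b\<in>UNIV. P k a b * cnj (X b a)) = (\<Sum>b\<in>UNIV. l k b * cnj (l k b))"
       "(\<Sum>a\<in>UNIV. \<Sum>b\<in>UNIV. X a b * cnj (X a b)) = (\<Sum>b\<in>UNIV. l k b * cnj (l k b))"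
       "(\<Sum>a\<in>UNIV. \<Sum>b\<in>UNIV. X a b * cnj (X b a)) = 0"
      using eq1 eq2 eq3 eq4 unfolding X_def by simp_all
    define L where "L = (\<Sum>b\<in>UNIV. l k b * cnj (l k b))"
    have cL: "cnj L = L" unfolding L_def by (simp add: mult.commute)
    have X': "(\<Sum>a\<in>UNIV. \<Sum>b\<in>UNIV. X a b * cnj (P k a b)) = L"
       "(\<Sum>a\<in>UNIV. \<Sum>b\<in>UNIV. X b a * cnj (P k a b)) = L"
       "(\<Sum>a\<in>UNIV. \<Sum>b\<in>UNIV. X b a * cnj (X b a)) = L"
       "(\<Sum>a\<in>UNIV. \<Sum>b\<in>UNIV. X b a * cnj (X a b)) = 0"
      using arg_cong[OF X(1), of cnj] arg_cong[OF X(2), of cnj] X(3) arg_cong[OF X(4), of cnj] cL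
      unfolding L_def[symmetric] by (simp_all add: mult.commute sum.swap[of "\<lambda>a b. X b a * cnj (X b a)"])
    have "(\<Sum>a\<in>UNIV. \<Sum>b\<in>UNIV. q k a b * cnj (q k a b))
      = (\<Sum>a\<in>UNIV. \<Sum>b\<in>UNIV. P k a b * cnj (P k a b) - P k a b * cnj (X a b) - P k a b * cnj (X b a)
         - X a b * cnj (P k a b) - X b a * cnj (P k a b) + X a b * cnj (X a b) + X a b * cnj (X b a)
         + X b a * cnj (X a b) + X b a * cnj (X b a))"
      unfolding q_def X_def[symmetric] by (intro sum.cong refl) (simp add: algebra_simps)
    also have "\<dots> = (\<Sum>a\<in>UNIV. \<Sum>b\<in>UNIV. P k a b * cnj (P k a b)) - 2 * L"
      unfolding sum.distrib sum_subtractf X X' L_def[symmetric] by simp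
    finally show ?thesis unfolding L_def .
  qed
  hence "(\<Sum>k\<in>UNIV. \<Sum>a\<in>UNIV. \<Sum>b\<in>UNIV. q k a b * cnj (q k a b)) = 0"
    by (simp add: sum_subtractf SP sum_distrib_left[symmetric] Sl)
  hence "q k a b = 0" by (rule sum_norm_eq_0D)
  thus ?thesis unfolding q_def P_def l_def by (simp add: algebra_simps)
qed

text \<open>Expanding the polar conic by \<open>flex\<close> leaves contractions of F with the
  point, which are polar conics again; a second use of \<open>flex\<close> leaves a multiple of the
  conjugate point. Thus every conjugate point is an eigenvector of one fixed 3 by 3 matrix built
  from F. Comparing coordinates of one such vector later relates the coefficients of the
  cubic.\<close>

lemma gram_eigenvector:
  assumes F: "vanishing F"
  shows "(\<Sum>a\<in>UNIV. \<Sum>b\<in>UNIV. cnj (polar2 F (z k) a b) * F a b d)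
    = 2 * (\<Sum>b\<in>UNIV. polar1 F (z k) b * cnj (polar1 F (z k) b)) * cnj (z k $ d)"
proof -
  note sym = vanishing_sym[OF F]
  define l where "l = polar1 F (z k)"
  have l0: "(\<Sum>b\<in>UNIV. cnj (l b) * cnj (z k $ b)) = 0"
    using arg_cong[OF vanishing_point[OF F, of k], of cnj] by (simp add: l_def)
  have A: "(\<Sum>b\<in>UNIV. \<Sum>a\<in>UNIV. z k $ a * cnj (l b) * F a b d)
      = cnj (z k $ d) * (\<Sum>b\<in>UNIV. l b * cnj (l b))"
  proof -
    have "(\<Sum>b\<in>UNIV. \<Sum>a\<in>UNIV. z k $ a * cnj (l b) * F a b d) = (\<Sum>b\<in>UNIV. cnj (l b) * polar2 F (z k) b d)"
      unfolding polar2_def sum_distrib_left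
      by (intro sum.cong refl) (metis sym mult.assoc mult.commute)
    also have "\<dots> = (\<Sum>b\<in>UNIV. cnj (l b) * cnj (z k $ b) * l d + cnj (z k $ d) * (l b * cnj (l b)))"
      unfolding flex[OF F] l_def[symmetric] by (simp add: algebra_simps)
    also have "\<dots> = cnj (z k $ d) * (\<Sum>b\<in>UNIV. l b * cnj (l b))"
      by (simp add: sum.distrib sum_distrib_right[symmetric] sum_distrib_left[symmetric] l0)
    finally show ?thesis .
  qed
  have "(\<Sum>a\<in>UNIV. \<Sum>b\<in>UNIV. cnj (polar2 F (z k) a b) * F a b d)
    = (\<Sum>a\<in>UNIV. \<Sum>b\<in>UNIV. z k $ a * cnj (l b) * F a b d) + (\<Sum>a\<in>UNIV. \<Sum>b\<in>UNIV. z k $ b * cnj (l a) * F a b d)"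
    unfolding flex[OF F] l_def[symmetric] by (simp add: algebra_simps sum.distrib)
  also have "(\<Sum>a\<in>UNIV. \<Sum>b\<in>UNIV. z k $ a * cnj (l b) * F a b d) = (\<Sum>b\<in>UNIV. \<Sum>a\<in>UNIV. z k $ a * cnj (l b) * F a b d)"
    by (rule sum.swap)
  also have "(\<Sum>a\<in>UNIV. \<Sum>b\<in>UNIV. z k $ b * cnj (l a) * F a b d) = (\<Sum>b\<in>UNIV. \<Sum>a\<in>UNIV. z k $ a * cnj (l b) * F a b d)"
    by (intro sum.cong refl) (metis sym(1))
  finally show ?thesis unfolding A l_def[symmetric] by (simp add: mult_ac)
qed

end

subsection \<open>Normal form with respect to two points\<close>

context sic begin

text \<open>The polar line is eliminated from the components of the flex identity, using that it
  vanishes at the point. Only \<sigma> up to sign is fixed by the hypotheses, so the lemma covers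
  both normalized points.\<close>

lemma flex_at_standard_point:
  assumes F: "vanishing F" and \<sigma>: "\<sigma> * \<sigma> = - 3" "cnj \<sigma> = - \<sigma>"
    and z: "z k $ 1 = 1 / 2" "z k $ 2 = \<sigma> / 2" "z k $ 3 = 0"
  shows "F 1 3 3 + \<sigma> * F 2 3 3 = 0"
    and "F 1 2 3 + \<sigma> * F 2 2 3 = 3 * F 1 2 3 - \<sigma> * F 1 1 3"
    and "F 1 1 1 + \<sigma> * F 1 1 2 = F 1 2 2 + \<sigma> * F 2 2 2"
    and "\<sigma> * (F 1 1 1 + 3 * F 1 2 2) = 0"
proof -
  note sym = vanishing_sym[OF F]
  define l where "l = polar1 F (z k)"
  have fl: "F a b 1 + \<sigma> * F a b 2 = 2 * (cnj (z k $ a) * l b + cnj (z k $ b) * l a)" for a b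
    using flex[OF F, of k a b] unfolding polar2_def l_def[symmetric] by (simp add: sum_3 z field_simps)
  have l: "l 1 + \<sigma> * l 2 = 0"
    using vanishing_point[OF F, of k] unfolding l_def[symmetric] by (simp add: sum_3 z field_simps)
  have perm: "F 3 3 1 = F 1 3 3" "F 3 3 2 = F 2 3 3" "F 1 3 1 = F 1 1 3" "F 1 3 2 = F 1 2 3" "F 2 3 1 = F 1 2 3"
    "F 2 3 2 = F 2 2 3" "F 2 2 1 = F 1 2 2" "F 1 2 1 = F 1 1 2"
    using sym by metis+
  have e: "F 1 3 3 + \<sigma> * F 2 3 3 = 0" "F 1 1 3 + \<sigma> * F 1 2 3 = l 3" "F 1 2 3 + \<sigma> * F 2 2 3 = - \<sigma> * l 3"
    "F 1 1 1 + \<sigma> * F 1 1 2 = 2 * l 1" "F 1 2 2 + \<sigma> * F 2 2 2 = - 2 * \<sigma> * l 2"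
    "F 1 1 2 + \<sigma> * F 1 2 2 = l 2 - \<sigma> * l 1"
    using fl[of 3 3] fl[of 1 3] fl[of 2 3] fl[of 1 1] fl[of 2 2] fl[of 1 2]
    by (simp_all add: z \<sigma> perm algebra_simps)
  show "F 1 3 3 + \<sigma> * F 2 3 3 = 0" by (rule e)
  show "F 1 2 3 + \<sigma> * F 2 2 3 = 3 * F 1 2 3 - \<sigma> * F 1 1 3"
  proof -
    have ss: "\<sigma> * (\<sigma> * x) = - 3 * x" for x using \<sigma>(1) by (simp only: mult.assoc[symmetric])
    show ?thesis using e(3) unfolding e(2)[symmetric] distrib_left mult_minus_left ss by simp
  qed
  show "F 1 1 1 + \<sigma> * F 1 1 2 = F 1 2 2 + \<sigma> * F 2 2 2"
    using e(4,5) l by algebra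
  show "\<sigma> * (F 1 1 1 + 3 * F 1 2 2) = 0"
    using e(4,6) l \<sigma>(1) by algebra
qed

end

text \<open>The two vectors have product (1 - 3) / 4 = -1/2, which is compatible with equidistance,
  and differ only in the sign of \<sigma>.\<close>

locale sic_standard = sic +
  fixes i j :: "3 \<times> 3" and \<sigma> :: complex
  assumes \<sigma>: "\<sigma> = \<i> * complex_of_real (sqrt 3)"
    and zi: "z i $ 1 = 1 / 2" "z i $ 2 = \<sigma> / 2" "z i $ 3 = 0"
    and zj: "z j $ 1 = 1 / 2" "z j $ 2 = - \<sigma> / 2" "z j $ 3 = 0"
begin

lemma \<sigma>_sq: "\<sigma> * \<sigma> = - 3" unfolding \<sigma> by (rule i_sqrt3_sq)

lemma \<sigma>_cnj: "cnj \<sigma> = - \<sigma>" unfolding \<sigma> by simp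

lemma \<sigma>_nz: "\<sigma> \<noteq> 0" using \<sigma>_sq by auto

lemma ij: "i \<noteq> j" using zi(2) zj(2) \<sigma>_nz by auto

lemma cubic_normal_form:
  assumes F: "vanishing F"
  shows "F 1 1 1 = 0" "F 1 2 2 = 0" "F 1 2 3 = 0" "F 1 3 3 = 0" "F 2 3 3 = 0"
    "F 2 2 2 = F 1 1 2" "F 2 2 3 = - F 1 1 3"
proof -
  have m: "(- \<sigma>) * (- \<sigma>) = - 3" "cnj (- \<sigma>) = - (- \<sigma>)" using \<sigma>_sq \<sigma>_cnj by auto
  note p = flex_at_standard_point[OF F \<sigma>_sq \<sigma>_cnj zi]
  note q = flex_at_standard_point[OF F m zj]
  \<comment> \<open>Sum and difference of a relation at the two normalized points separate its parts
    even and odd in \<sigma>.\<close>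
  have *: "x = 0 \<and> y = 0" if "x + \<sigma> * y = 0" "x + (- \<sigma>) * y = 0" for x y
  proof -
    have "2 * x = 0" "2 * (\<sigma> * y) = 0" using that by algebra+
    thus ?thesis using \<sigma>_nz by simp
  qed
  show "F 1 3 3 = 0" "F 2 3 3 = 0" using *[OF p(1) q(1)] by auto
  have "- 2 * F 1 2 3 + \<sigma> * (F 2 2 3 + F 1 1 3) = 0" "- 2 * F 1 2 3 + (- \<sigma>) * (F 2 2 3 + F 1 1 3) = 0"
    using p(2) q(2) by (simp_all only: ring_distribs mult_minus_left) (simp_all add: add_eq_0_iff2 eq_diff_eq)
  from *[OF this] show "F 1 2 3 = 0" "F 2 2 3 = - F 1 1 3" by (auto simp: add_eq_0_iff)
  have "(F 1 1 1 - F 1 2 2) + \<sigma> * (F 1 1 2 - F 2 2 2) = 0" "(F 1 1 1 - F 1 2 2) + (- \<sigma>) * (F 1 1 2 - F 2 2 2) = 0"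
    using p(3) q(3) by (auto simp: algebra_simps)
  from *[OF this] have 1: "F 1 1 1 = F 1 2 2" and "F 2 2 2 = F 1 1 2" by auto
  thus "F 2 2 2 = F 1 1 2" by simp
  have "F 1 1 1 + 3 * F 1 2 2 = 0" using p(4) \<sigma>_nz by simp
  with 1 have "4 * F 1 2 2 = 0" by simp
  thus "F 1 2 2 = 0" by simp
  with 1 show "F 1 1 1 = 0" by simp
qed

text \<open>The first two relations are the half sum and the difference of the equidistance
  conditions to the two normalized points; the third follows by comparing the first with the unit
  norm.\<close>

lemma other_point:
  assumes k: "k \<noteq> i" "k \<noteq> j"
  shows "z k $ 1 * cnj (z k $ 1) + 3 * (z k $ 2 * cnj (z k $ 2)) = 1"
    and "z k $ 1 * cnj (z k $ 2) = z k $ 2 * cnj (z k $ 1)"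
    and "z k $ 3 * cnj (z k $ 3) = 2 * (z k $ 2 * cnj (z k $ 2))"
proof -
  define x y w where "x = z k $ 1" and "y = z k $ 2" and "w = z k $ 3"
  have 1: "(x - \<sigma> * y) * (cnj x + \<sigma> * cnj y) = 1"
  proof -
    have h: "herm (z i) (z k) = (x - \<sigma> * y) / 2" "herm (z k) (z i) = (cnj x + \<sigma> * cnj y) / 2"
      unfolding herm_def by (simp_all add: sum_3 zi \<sigma>_cnj x_def y_def field_simps)
    show ?thesis using equi[OF k(1)[symmetric]] unfolding h by simp
  qed
  have 2: "(x + \<sigma> * y) * (cnj x - \<sigma> * cnj y) = 1"
  proof -
    have h: "herm (z j) (z k) = (x + \<sigma> * y) / 2" "herm (z k) (z j) = (cnj x - \<sigma> * cnj y) / 2"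
      unfolding herm_def by (simp_all add: sum_3 zj \<sigma>_cnj x_def y_def field_simps)
    show ?thesis using equi[OF k(2)[symmetric]] unfolding h by simp
  qed
  have 3: "cnj x * x + cnj y * y + cnj w * w = 1"
    using unit[of k] unfolding herm_def by (simp add: sum_3 x_def y_def w_def)
  have "2 * (x * cnj x + 3 * (y * cnj y)) = 2" using 1 2 \<sigma>_sq by algebra
  hence "2 * (x * cnj x + 3 * (y * cnj y)) = 2 * 1" by (simp only: mult_1_right)
  hence 4: "x * cnj x + 3 * (y * cnj y) = 1" by (simp only: mult_cancel_left) simp
  have "2 * \<sigma> * (x * cnj y - y * cnj x) = 0" using 1 2 by algebra
  hence 5: "x * cnj y = y * cnj x" using \<sigma>_nz by simp
  have 6: "w * cnj w = 2 * (y * cnj y)" using 3 4 by algebra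
  show "z k $ 1 * cnj (z k $ 1) + 3 * (z k $ 2 * cnj (z k $ 2)) = 1"
    "z k $ 1 * cnj (z k $ 2) = z k $ 2 * cnj (z k $ 1)"
    "z k $ 3 * cnj (z k $ 3) = 2 * (z k $ 2 * cnj (z k $ 2))"
    using 4 5 6 unfolding x_def y_def w_def by auto
qed

text \<open>Affine coordinates that bring a point to \<open>[r, 1, sqrt 2 u]\<close>. By
  \<open>other_point\<close> the quotient inside \<open>Re\<close> is already real and
  \<open>u\<close> has modulus 1. The torus is pinched because a point with second coordinate 0 can
  only be \<open>[1, 0, 0]\<close>.\<close>

definition r :: "3 \<times> 3 \<Rightarrow> real" where "r k = Re (z k $ 1 / z k $ 2)"
definition u :: "3 \<times> 3 \<Rightarrow> complex" where "u k = z k $ 3 / (complex_of_real (sqrt 2) * z k $ 2)"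

lemma pinched_torus:
  assumes k: "k \<noteq> i" "k \<noteq> j" and y: "z k $ 2 \<noteq> 0"
  shows "z k $ 1 = z k $ 2 * of_real (r k)"
    and "z k $ 3 = z k $ 2 * (of_real (sqrt 2) * u k)"
    and "u k * cnj (u k) = 1"
    and "z k $ 2 * cnj (z k $ 2) * of_real ((r k)\<^sup>2 + 3) = 1"
proof -
  note o = other_point[OF k]
  have "cnj (z k $ 1 / z k $ 2) = z k $ 1 / z k $ 2"
    using o(2) y by (simp add: field_simps)
  hence "z k $ 1 / z k $ 2 = of_real (r k)" unfolding r_def by (metis Reals_cnj_iff of_real_Re)
  thus x: "z k $ 1 = z k $ 2 * of_real (r k)" using y by (simp add: field_simps)
  show "z k $ 3 = z k $ 2 * (of_real (sqrt 2) * u k)" unfolding u_def using y by simp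
  have "u k * cnj (u k) = (z k $ 3 * cnj (z k $ 3)) /
      ((complex_of_real (sqrt 2) * complex_of_real (sqrt 2)) * (z k $ 2 * cnj (z k $ 2)))"
    unfolding u_def by simp
  also have "\<dots> = 1" unfolding of_real_sqrt2_sq o(3) using y by simp
  finally show "u k * cnj (u k) = 1" .
  show "z k $ 2 * cnj (z k $ 2) * of_real ((r k)\<^sup>2 + 3) = 1"
    using o(1) unfolding x by (simp add: power2_eq_square algebra_simps)
qed

text \<open>By normalization the squared modulus of the second coordinate is
  \<open>1 / (r\<^sup>2 + 3)\<close>, so equidistance becomes a condition on \<open>r\<close> and
  \<open>u\<close> alone.\<close>

lemma pair_equation:
  assumes k: "k \<noteq> i" "k \<noteq> j" "z k $ 2 \<noteq> 0" and l: "l \<noteq> i" "l \<noteq> j" "z l $ 2 \<noteq> 0" and "k \<noteq> l"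
  shows "4 * (cmod (of_real (1 + r k * r l) + 2 * (cnj (u k) * u l)))\<^sup>2 = ((r k)\<^sup>2 + 3) * ((r l)\<^sup>2 + 3)"
proof -
  note pk = pinched_torus[OF k] and pl = pinched_torus[OF l]
  define X where "X = of_real (1 + r k * r l) + 2 * (cnj (u k) * u l)"
  have h: "herm (z k) (z l) = cnj (z k $ 2) * z l $ 2 * X"
  proof -
    have "herm (z k) (z l) = cnj (z k $ 2) * z l $ 2 *
       (of_real (1 + r k * r l) + (of_real (sqrt 2) * of_real (sqrt 2)) * (cnj (u k) * u l))"
      unfolding herm_def by (simp add: sum_3 pk(1,2) pl(1,2) algebra_simps)
    thus ?thesis unfolding of_real_sqrt2_sq X_def .
  qed
  have "1 / 4 = herm (z k) (z l) * cnj (herm (z k) (z l))"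
    using equi[OF \<open>k \<noteq> l\<close>] herm_commute[of "z l" "z k"] by simp
  also have "\<dots> = (z k $ 2 * cnj (z k $ 2)) * (z l $ 2 * cnj (z l $ 2)) * (X * cnj X)"
    unfolding h by (simp add: mult_ac)
  finally have eq: "1 / 4 = (z k $ 2 * cnj (z k $ 2)) * (z l $ 2 * cnj (z l $ 2)) * (X * cnj X)" .
  have "of_real ((r k)\<^sup>2 + 3) * of_real ((r l)\<^sup>2 + 3) = 4 * (X * cnj X)"
    using eq pk(4) pl(4) by algebra
  hence "complex_of_real (((r k)\<^sup>2 + 3) * ((r l)\<^sup>2 + 3)) = of_real (4 * (cmod X)\<^sup>2)"
    by (simp only: complex_norm_square of_real_mult of_real_numeral)
  thus ?thesis unfolding X_def[symmetric] by (simp only: of_real_eq_iff)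
qed

lemma cubic_equation:
  assumes F: "vanishing F" and k: "k \<noteq> i" "k \<noteq> j" "z k $ 2 \<noteq> 0"
  shows "F 1 1 2 * of_real (3 * (r k)\<^sup>2 + 1) + 3 * of_real (sqrt 2) * F 1 1 3 * u k * of_real ((r k)\<^sup>2 - 1)
     + 2 * of_real (sqrt 2) * F 3 3 3 * u k ^ 3 = 0"
    and "F 3 3 3 * cnj (F 3 3 3) = 2 * (F 1 1 2 * cnj (F 1 1 2))"
proof -
  note p = pinched_torus[OF k]
  note n = cubic_normal_form[OF F]
  note sym = vanishing_sym[OF F]
  define q where "q = complex_of_real (sqrt 2)"
  have qq: "q * q = 2" unfolding q_def by (rule of_real_sqrt2_sq)
  have perm: "F 1 2 1 = F 1 1 2" "F 2 1 1 = F 1 1 2" "F 1 3 1 = F 1 1 3" "F 3 1 1 = F 1 1 3"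
    "F 2 1 2 = 0" "F 2 2 1 = 0" "F 1 3 2 = 0" "F 2 1 3 = 0" "F 2 3 1 = 0" "F 3 1 2 = 0" "F 3 2 1 = 0"
    "F 3 1 3 = 0" "F 3 3 1 = 0" "F 2 3 2 = - F 1 1 3" "F 3 2 2 = - F 1 1 3" "F 3 2 3 = 0" "F 3 3 2 = 0"
    using n sym by metis+
  have "cubic F (z k) = 0" using F unfolding vanishing_def by blast
  hence "z k $ 2 * (z k $ 2 * z k $ 2) * (F 1 1 2 * of_real (3 * (r k)\<^sup>2 + 1) + 3 * q * F 1 1 3 * u k * of_real ((r k)\<^sup>2 - 1)
     + (q * q) * q * F 3 3 3 * u k ^ 3) = 0"
    unfolding cubic_def polar1_def polar2_def
    by (simp add: sum_3 n perm p(1,2) q_def[symmetric] power2_eq_square power3_eq_cube algebra_simps)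
  thus "F 1 1 2 * of_real (3 * (r k)\<^sup>2 + 1) + 3 * of_real (sqrt 2) * F 1 1 3 * u k * of_real ((r k)\<^sup>2 - 1)
     + 2 * of_real (sqrt 2) * F 3 3 3 * u k ^ 3 = 0"
    using k(3) unfolding qq q_def[symmetric] by (simp only: mult_eq_0_iff) simp
  \<comment> \<open>\<open>m\<close> is the eigenvalue of \<open>gram_eigenvector\<close>. In normal
    form the matrix is diagonal, and the second and third coordinates of the point are nonzero, so
    the corresponding diagonal entries both equal \<open>m\<close>.\<close>
  define m where "m = 2 * (\<Sum>b\<in>UNIV. polar1 F (z k) b * cnj (polar1 F (z k) b))"
  have u0: "u k \<noteq> 0" using p(3) by auto
  have w0: "z k $ 3 \<noteq> 0" unfolding p(2) using k(3) u0 by simp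
  have "cnj (z k $ 2) * (2 * (F 1 1 2 * cnj (F 1 1 2)) + 2 * (F 1 1 3 * cnj (F 1 1 3))) = m * cnj (z k $ 2)"
    using gram_eigenvector[OF F, of k 2] unfolding m_def[symmetric] polar2_def
    by (simp add: sum_3 n perm algebra_simps)
  hence 2: "2 * (F 1 1 2 * cnj (F 1 1 2)) + 2 * (F 1 1 3 * cnj (F 1 1 3)) = m" using k(3) by simp
  have "cnj (z k $ 3) * (F 3 3 3 * cnj (F 3 3 3) + 2 * (F 1 1 3 * cnj (F 1 1 3))) = m * cnj (z k $ 3)"
    using gram_eigenvector[OF F, of k 3] unfolding m_def[symmetric] polar2_def
    by (simp add: sum_3 n perm algebra_simps)
  hence 3: "F 3 3 3 * cnj (F 3 3 3) + 2 * (F 1 1 3 * cnj (F 1 1 3)) = m" using w0 by simp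
  show "F 3 3 3 * cnj (F 3 3 3) = 2 * (F 1 1 2 * cnj (F 1 1 2))" using 2 3 by (metis add_right_imp_eq)
qed

lemma cubic_nonzero:
  assumes F: "vanishing F" and ex: "\<exists>a b c. F a b c \<noteq> 0" and "F 1 1 2 = 0" "F 3 3 3 = 0"
  shows "F 1 1 3 \<noteq> 0"
proof
  assume "F 1 1 3 = 0"
  note n = cubic_normal_form[OF F] and sym = vanishing_sym[OF F]
  have "F a b c = 0" for a b c
    using exhaust_3[of a] exhaust_3[of b] exhaust_3[of c] n sym assms(3,4) \<open>F 1 1 3 = 0\<close>
    by (smt (verit) neg_equal_0_iff_equal)
  thus False using ex by blast
qed

end

subsection \<open>Existence of a collinear triple\<close>

text \<open>The index set is left open: it is instantiated with the seven points off the normalized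
  pair, and later with the six points off a collinear triple.\<close>

locale torus_points =
  fixes K :: "'k set" and r :: "'k \<Rightarrow> real" and u :: "'k \<Rightarrow> complex"
  assumes unit_u: "k \<in> K \<Longrightarrow> u k * cnj (u k) = 1"
    and pair: "k \<in> K \<Longrightarrow> l \<in> K \<Longrightarrow> k \<noteq> l \<Longrightarrow>
      4 * (cmod (of_real (1 + r k * r l) + 2 * (cnj (u k) * u l)))\<^sup>2 = ((r k)\<^sup>2 + 3) * ((r l)\<^sup>2 + 3)"
begin

lemma u_nz: "k \<in> K \<Longrightarrow> u k \<noteq> 0"
  using unit_u by fastforce

lemma pair_same_u:
  assumes "k \<in> K" "l \<in> K" "k \<noteq> l" "u k = u l"
  shows "4 * (3 + r k * r l)\<^sup>2 = ((r k)\<^sup>2 + 3) * ((r l)\<^sup>2 + 3)"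
proof -
  have "of_real (1 + r k * r l) + 2 * (cnj (u k) * u l) = complex_of_real (3 + r k * r l)"
    using unit_u[OF assms(1)] assms(4) by (simp add: mult.commute)
  thus ?thesis using pair[OF assms(1-3)] by (simp only: norm_of_real power2_abs)
qed

lemma same_point:
  assumes "k \<in> K" "l \<in> K" "u k = u l" "r k = r l"
  shows "k = l"
proof (rule ccontr)
  assume "k \<noteq> l"
  from pair_same_u[OF assms(1,2) this assms(3)] assms(4)
  have "3 * ((r l)\<^sup>2 + 3)\<^sup>2 = 0" by (simp add: power2_eq_square algebra_simps)
  moreover have "(r l)\<^sup>2 + 3 > 0" by (simp add: add_nonneg_pos)
  ultimately show False by simp
qed

text \<open>Equal \<open>r\<close> is excluded by \<open>same_point\<close>, so \<open>r\<close>
  changes sign; \<open>pair_same_u\<close> then becomes a quadratic equation for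
  \<open>r\<^sup>2\<close> with roots 1 and 9.\<close>

lemma opposite_points:
  assumes "k \<in> K" "l \<in> K" "k \<noteq> l" "u k = u l" "(r k)\<^sup>2 = (r l)\<^sup>2" "(r k)\<^sup>2 \<noteq> 1"
  shows "r k = 3 \<and> r l = - 3 \<or> r k = - 3 \<and> r l = 3"
proof -
  have opp: "r k = - r l"
    using same_point[OF assms(1,2,4)] assms(3,5) by (auto simp: power2_eq_iff)
  from pair_same_u[OF assms(1-4)] have "3 * (((r l)\<^sup>2 - 1) * ((r l)\<^sup>2 - 9)) = 0"
    unfolding opp by (simp add: power2_eq_square algebra_simps)
  hence "(r l)\<^sup>2 = 3\<^sup>2" using assms(5,6) by simp
  hence "r l = 3 \<or> r l = - 3" by (simp only: power2_eq_iff)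
  thus ?thesis using opp by auto
qed

text \<open>For \<open>r = 3\<close> at both points the left side of \<open>pair\<close> is at least
  4 * 64 = 256 by the triangle inequality, while the right side is 144.\<close>

lemma not_both_three:
  assumes "k \<in> K" "l \<in> K" "k \<noteq> l" "r k = 3" "r l = 3"
  shows False
proof -
  have "cmod (cnj (u k) * u l) = 1"
    using cmod_eqI[of "u k" 1] cmod_eqI[of "u l" 1] unit_u assms(1,2) by (simp add: norm_mult)
  hence "cmod (of_real (1 + r k * r l) + 2 * (cnj (u k) * u l)) \<ge> 10 - 2"
    using norm_diff_ineq[of "of_real (1 + r k * r l)" "2 * (cnj (u k) * u l)"] assms(4,5) by (simp add: norm_mult)
  hence "(cmod (of_real (1 + r k * r l) + 2 * (cnj (u k) * u l)))\<^sup>2 \<ge> 8\<^sup>2" by (intro power_mono) auto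
  thus False using pair[OF assms(1-3)] assms(4,5) by simp
qed

lemma signs_pigeonhole:
  assumes "finite A" "A \<subseteq> K" "card A \<ge> 5" "\<And>k. k \<in> A \<Longrightarrow> (r k)\<^sup>2 = 1"
  shows "\<exists>k\<in>K. \<exists>l\<in>K. \<exists>m\<in>K. k \<noteq> l \<and> k \<noteq> m \<and> l \<noteq> m \<and> r k = r l \<and> r l = r m"
proof -
  define P where "P e = {k\<in>A. r k = e}" for e
  have "A = P 1 \<union> P (- 1)" using assms(4) unfolding P_def by (auto simp: power2_eq_1_iff)
  hence "card A \<le> card (P 1) + card (P (- 1))" by (metis card_Un_le)
  hence "card (P 1) \<ge> 3 \<or> card (P (- 1)) \<ge> 3" using assms(3) by linarith
  then obtain e where "card (P e) \<ge> 3" by blast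
  then obtain T where T: "T \<subseteq> P e" "card T = 3" by (metis obtain_subset_with_card_n)
  then obtain k l m where "T = {k, l, m}" "k \<noteq> l" "k \<noteq> m" "l \<noteq> m" by (metis card_3_iff)
  moreover from this have "k \<in> K" "l \<in> K" "m \<in> K" "r k = e" "r l = e" "r m = e"
    using T(1) assms(2) unfolding P_def by auto
  ultimately show ?thesis by metis
qed

text \<open>Solving the cubic equation for \<open>(r k)\<^sup>2\<close> and equating the result with its complex conjugate shows
  that \<open>u k\<close> is a root of one fixed cubic polynomial whenever \<open>(r k)\<^sup>2 \<noteq> 1\<close>. A root taken twice forces
  \<open>r = \<plusminus>3\<close>, which cannot happen for two roots, so at most four of the seven points have \<open>(r k)\<^sup>2 \<noteq> 1\<close>.
  The others have \<open>r k = \<plusminus>1\<close> and equal values of \<open>(u k)\<^sup>3\<close>, and three such points are enough. The third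
  alternative means that the points \<open>k\<close> and \<open>l\<close> are collinear with one of the two normalized points.\<close>

lemma collinear_triple_exists:
  assumes K: "finite K" "card K = 7"
    and cubic: "\<And>k. k \<in> K \<Longrightarrow> c * of_real (3 * (r k)\<^sup>2 + 1) + 3 * of_real (sqrt 2) * s * u k * of_real ((r k)\<^sup>2 - 1)
       + 2 * of_real (sqrt 2) * g * u k ^ 3 = 0"
    and norms: "g * cnj g = 2 * (c * cnj c)"
    and nz: "c = 0 \<Longrightarrow> g = 0 \<Longrightarrow> s \<noteq> 0"
  shows "(\<exists>k\<in>K. \<exists>l\<in>K. \<exists>m\<in>K. k \<noteq> l \<and> k \<noteq> m \<and> l \<noteq> m \<and> r k = r l \<and> r l = r m)
    \<or> (\<exists>k\<in>K. \<exists>l\<in>K. \<exists>m\<in>K. k \<noteq> l \<and> k \<noteq> m \<and> l \<noteq> m \<and> u k = u l \<and> u l = u m)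
    \<or> (\<exists>k\<in>K. \<exists>l\<in>K. r k = 1 \<and> r l = - 1 \<and> (u k)\<^sup>2 + u k * u l + (u l)\<^sup>2 = 0)"
    (is "?R \<or> ?U \<or> ?X")
proof (cases "c = 0")
  case True
  hence g: "g = 0" using norms by simp
  hence s: "s \<noteq> 0" using nz True by simp
  have "(r k)\<^sup>2 = 1" if "k \<in> K" for k
  proof -
    have "complex_of_real ((r k)\<^sup>2 - 1) = 0"
      using cubic[OF that] True g s u_nz[OF that] by (simp del: of_real_diff)
    hence "(r k)\<^sup>2 - 1 = 0" by (simp only: of_real_eq_0_iff)
    thus ?thesis by simp
  qed
  thus ?thesis using signs_pigeonhole[of K] K by auto
next
  case c: False
  define q where "q = complex_of_real (sqrt 2)"
  have qq: "q * q = 2" unfolding q_def by (rule of_real_sqrt2_sq)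
  have q0: "q \<noteq> 0" using qq by auto
  have cq: "cnj q = q" unfolding q_def by simp
  \<comment> \<open>Dividing the cubic equation by \<open>c\<close> leaves two parameters, and
    \<open>norms\<close> says exactly that \<eta> has modulus 1.\<close>
  define \<eta> where "\<eta> = - (g / (q * c))"
  define \<kappa> where "\<kappa> = 3 * q * s / c"
  have \<eta>1: "\<eta> * cnj \<eta> = 1"
  proof -
    have "\<eta> * cnj \<eta> = (g * cnj g) / ((q * q) * (c * cnj c))" unfolding \<eta>_def by (simp add: cq)
    thus ?thesis unfolding norms qq using c by simp
  qed
  have main: "of_real ((r k)\<^sup>2 - 1) * (3 + \<kappa> * u k) = 4 * (\<eta> * u k ^ 3 - 1)" if "k \<in> K" for k
  proof -
    have g: "2 * q * g = - 4 * \<eta> * c"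
    proof -
      have "- 4 * \<eta> * c = 4 * g / q" unfolding \<eta>_def using c q0 by simp
      also have "\<dots> = 2 * q * g" using qq q0 by (simp add: field_simps) 
      finally show ?thesis ..
    qed
    have s: "3 * q * s = \<kappa> * c" unfolding \<kappa>_def using c by simp
    have "c * of_real (3 * (r k)\<^sup>2 + 1) + (3 * q * s) * u k * of_real ((r k)\<^sup>2 - 1) + (2 * q * g) * u k ^ 3 = 0"
      using cubic[OF that] unfolding q_def by simp
    hence "c * (of_real ((r k)\<^sup>2 - 1) * (3 + \<kappa> * u k) - 4 * (\<eta> * u k ^ 3 - 1)) = 0"
      unfolding g s by (simp add: algebra_simps)
    thus ?thesis using c by simp
  qed
  define A where "A = {k\<in>K. (r k)\<^sup>2 = 1}"
  define B where "B = {k\<in>K. (r k)\<^sup>2 \<noteq> 1}"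
  have uA: "\<eta> * u k ^ 3 = 1" if "k \<in> A" for k
  proof -
    have "complex_of_real ((r k)\<^sup>2 - 1) = 0" and "k \<in> K" using that unfolding A_def by auto
    thus ?thesis using main[of k] by (simp del: of_real_diff)
  qed
  have uB: "3 + \<kappa> * u k + \<eta> * cnj \<kappa> * (u k)\<^sup>2 + 3 * \<eta> * u k ^ 3 = 0" if "k \<in> B" for k
  proof -
    define R where "R = complex_of_real ((r k)\<^sup>2 - 1)"
    have k: "k \<in> K" and R0: "R \<noteq> 0" using that unfolding B_def R_def by (auto simp del: of_real_diff)
    have 1: "R * (3 + \<kappa> * u k) = 4 * (\<eta> * u k ^ 3 - 1)" unfolding R_def by (rule main[OF k])
    have cR: "cnj R = R" unfolding R_def by simp
    have 2: "R * (3 + cnj \<kappa> * cnj (u k)) = 4 * (cnj \<eta> * cnj (u k) ^ 3 - 1)"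
      using arg_cong[OF 1, of cnj] by (simp add: cR)
    \<comment> \<open>Multiplying the conjugate equation by \<open>\<eta> * u k ^ 3\<close> turns
      its right side into the negative of that of the original equation; adding both eliminates
      it.\<close>
    have "R * (3 + \<kappa> * u k + \<eta> * cnj \<kappa> * (u k)\<^sup>2 + 3 * \<eta> * u k ^ 3) = 0"
      using 1 2 unit_u[OF k] \<eta>1 by algebra
    thus ?thesis using R0 by simp
  qed
  define p where "p = [:3, \<kappa>, \<eta> * cnj \<kappa>, 3 * \<eta>:]"
  have p0: "p \<noteq> 0" unfolding p_def by simp
  have roots: "finite {x. poly p x = 0}" "card {x. poly p x = 0} \<le> 3"
  proof -
    show "finite {x. poly p x = 0}" using p0 by (rule poly_roots_finite)
    have "degree p \<le> 3" unfolding p_def by (simp add: degree_pCons_eq_if)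
    thus "card {x. poly p x = 0} \<le> 3" using card_poly_roots_bound[OF p0] by linarith
  qed
  have uB_root: "u ` B \<subseteq> {x. poly p x = 0}"
    using uB unfolding p_def by (auto simp: power2_eq_square power3_eq_cube algebra_simps)
  \<comment> \<open>If the factor of the real number \<open>R\<close> vanishes at
    \<open>u k\<close>, then the cubic polynomial has \<open>u k\<close> as a double root and
    \<open>- u k\<close> as third root. The latter would give
    \<open>3 * (r l)\<^sup>2 = - 1\<close>.\<close>
  have degenerate: "u l = u k" if k: "k \<in> B" and l: "l \<in> B" and deg: "3 + \<kappa> * u k = 0" for k l
  proof -
    have kK: "k \<in> K" and lK: "l \<in> K" using k l unfolding B_def by auto
    have \<eta>k: "\<eta> * u k ^ 3 = 1" using main[OF kK] deg by simp
    define t where "t = u l * cnj (u k)"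
    have ul: "u l = t * u k" unfolding t_def using unit_u[OF kK] by (simp add: mult_ac)
    have \<kappa>: "\<kappa> = - 3 * cnj (u k)" using deg unit_u[OF kK] by algebra
    have ck: "cnj \<kappa> = - 3 * u k" unfolding \<kappa> by simp
    have "3 * ((t - 1)\<^sup>2 * (t + 1)) = 3 + \<kappa> * u l + \<eta> * cnj \<kappa> * (u l)\<^sup>2 + 3 * \<eta> * u l ^ 3"
      unfolding ul ck using \<eta>k deg by algebra
    hence "(t - 1)\<^sup>2 * (t + 1) = 0" using uB[OF l] by simp
    hence "t = 1 \<or> t = - 1" by (simp add: eq_neg_iff_add_eq_0)
    moreover have False if "t = - 1"
    proof -
      have "of_real ((r l)\<^sup>2 - 1) * 6 = (- 8 :: complex)"
        using main[OF lK] ul that \<eta>k deg by algebra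
      hence "complex_of_real (((r l)\<^sup>2 - 1) * 6) = of_real (- 8)" by simp
      hence "((r l)\<^sup>2 - 1) * 6 = - 8" by (simp only: of_real_eq_iff)
      hence "3 * (r l)\<^sup>2 = - 1" by simp
      moreover have "0 \<le> 3 * (r l)\<^sup>2" by simp
      ultimately show False by simp
    qed
    ultimately show ?thesis using ul by auto
  qed
  \<comment> \<open>A nonzero factor means that \<open>u\<close> determines
    \<open>r\<^sup>2\<close>, so two points over the same root fall under
    \<open>opposite_points\<close>.\<close>
  have double: "\<exists>m\<in>{k, l}. r m = 3" if "k \<in> B" "l \<in> B" "k \<noteq> l" "u k = u l" "3 + \<kappa> * u k \<noteq> 0" for k l
  proof -
    have K': "k \<in> K" "l \<in> K" using that unfolding B_def by auto
    have "of_real ((r k)\<^sup>2 - 1) * (3 + \<kappa> * u k) = of_real ((r l)\<^sup>2 - 1) * (3 + \<kappa> * u k)"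
      using main[OF K'(1)] main[OF K'(2)] that(4) by simp
    hence "complex_of_real ((r k)\<^sup>2 - 1) = of_real ((r l)\<^sup>2 - 1)" using that(5) by simp
    hence "(r k)\<^sup>2 - 1 = (r l)\<^sup>2 - 1" by (simp only: of_real_eq_iff)
    hence "(r k)\<^sup>2 = (r l)\<^sup>2" by simp
    moreover have "(r k)\<^sup>2 \<noteq> 1" using that(1) unfolding B_def by simp
    ultimately show ?thesis using opposite_points[OF K' that(3,4)] by auto
  qed
  have two_doubles: False if "k \<in> B" "k' \<in> B" "k \<noteq> k'" "u k = u k'"
    "l \<in> B" "l' \<in> B" "l \<noteq> l'" "u l = u l'" "u k \<noteq> u l" for k k' l l'
  proof -
    note hyps = that
    have nd: "3 + \<kappa> * u k \<noteq> 0" "3 + \<kappa> * u l \<noteq> 0"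
      using degenerate[of k l] degenerate[of l k] that by auto
    obtain m where m: "m \<in> {k, k'}" "r m = 3"
      using double[of k k'] hyps(1-4) nd(1) by blast
    obtain n where n: "n \<in> {l, l'}" "r n = 3"
      using double[of l l'] hyps(5-8) nd(2) by blast
    have "m \<in> K" "n \<in> K" "m \<noteq> n" using m n hyps unfolding B_def by auto
    thus False using not_both_three m(2) n(2) by blast
  qed
  show ?thesis
  proof (rule ccontr)
    assume neg: "\<not> (?R \<or> ?U \<or> ?X)"
    have finB: "finite B" "B \<subseteq> K" unfolding B_def using K by auto
    have inj_card: "card C \<le> 3" if "C \<subseteq> B" "inj_on u C" for C
    proof -
      have "card C = card (u ` C)" using card_image[OF that(2)] by simp
      also have "\<dots> \<le> card {x. poly p x = 0}" using roots(1) uB_root that(1) by (intro card_mono) auto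
      finally show ?thesis using roots(2) by simp
    qed
    \<comment> \<open>There are at most three roots, no root carries three points, and at most one
      root carries two.\<close>
    have cB: "card B \<le> 4"
    proof (cases "inj_on u B")
      case True
      thus ?thesis using inj_card[of B] by simp
    next
      case False
      then obtain k1 k2 where k12: "k1 \<in> B" "k2 \<in> B" "k1 \<noteq> k2" "u k1 = u k2" unfolding inj_on_def by blast
      have "inj_on u (B - {k1})"
      proof (rule inj_onI, rule ccontr)
        fix k l assume kl: "k \<in> B - {k1}" "l \<in> B - {k1}" "u k = u l" "k \<noteq> l"
        show False
        proof (cases "u k = u k1")
          case True
          have "k1 \<in> K" "k \<in> K" "l \<in> K" "k1 \<noteq> k" "k1 \<noteq> l" using kl k12(1) finB(2) by auto
          hence ?U using kl(3,4) True by metis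
          thus False using neg by blast
        next
          case False
          thus False using two_doubles[OF k12, of k l] kl by (metis DiffD1)
        qed
      qed
      hence "card (B - {k1}) \<le> 3" using inj_card[of "B - {k1}"] by blast
      thus ?thesis using k12(1) finB(1) by (simp add: card_Diff_singleton)
    qed
    have "K = A \<union> B" "A \<inter> B = {}" "finite A" "A \<subseteq> K" unfolding A_def B_def using K by auto
    hence cA: "card A \<ge> 3" using K(2) cB finB card_Un_disjoint[of A B] by simp
    then obtain T where T: "T \<subseteq> A" "card T = 3" by (metis obtain_subset_with_card_n)
    then obtain a b d where abd: "T = {a, b, d}" "a \<noteq> b" "a \<noteq> d" "b \<noteq> d" by (metis card_3_iff)
    have inA: "a \<in> A" "b \<in> A" "d \<in> A" using T abd by auto
    have sgn: "r k = 1 \<or> r k = - 1" if "k \<in> A" for k using that unfolding A_def by (auto simp: power2_eq_1_iff)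
    have AK: "k \<in> K" if "k \<in> A" for k using that unfolding A_def by simp
    \<comment> \<open>On \<open>A\<close> all cubes of \<open>u\<close> agree. Opposite signs of
      \<open>r\<close> with different \<open>u\<close> would be the excluded third alternative.
      Among three points of \<open>A\<close> with mixed signs, two share their sign and both have
      the \<open>u\<close> of the remaining one, so they coincide.\<close>
    have opp_same_u: "u k = u l" if "k \<in> A" "l \<in> A" "r k \<noteq> r l" for k l
    proof -
      have "(u k - u l) * ((u k)\<^sup>2 + u k * u l + (u l)\<^sup>2) = 0"
        using uA[OF that(1)] uA[OF that(2)] \<eta>1 by algebra
      hence "u k = u l \<or> (u k)\<^sup>2 + u k * u l + (u l)\<^sup>2 = 0" by simp
      moreover have "r k = 1 \<and> r l = - 1 \<or> r l = 1 \<and> r k = - 1" using sgn that by metis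
      ultimately show ?thesis using neg AK[OF that(1)] AK[OF that(2)] by (auto simp: algebra_simps)
    qed
    have not3: "\<not> (r a = r b \<and> r b = r d)" using neg AK inA abd(2-4) by blast
    have "\<exists>k\<in>A. \<exists>l\<in>A. \<exists>m\<in>A. k \<noteq> l \<and> r k = r l \<and> r m \<noteq> r k"
    proof (cases "r a = r b")
      case True thus ?thesis using not3 inA abd by metis
    next
      case False
      hence "r d = r a \<or> r d = r b" using sgn inA by metis
      thus ?thesis using False inA abd by metis
    qed
    then obtain k l m where klm: "k \<in> A" "l \<in> A" "m \<in> A" "k \<noteq> l" "r k = r l" "r m \<noteq> r k" by blast
    hence "u k = u l" using opp_same_u[of m k] opp_same_u[of m l] by metis
    thus False using same_point[of k l] klm AK by blast
  qed
qed

end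

subsection \<open>Moving two points to standard position\<close>

lemma herm_scale: "herm (c *s v) (d *s w) = cnj c * d * herm v w"
  unfolding herm_def sum_distrib_left by (intro sum.cong refl) (simp add: mult_ac)

lemma herm_add: "herm v (w + x) = herm v w + herm v x" "herm (v + w) x = herm v x + herm w x"
  unfolding herm_def by (simp_all add: sum.distrib ring_distribs)

lemma herm_SU3:
  assumes "X \<in> SU3"
  shows "herm (X *v v) (X *v w) = herm v w"
proof -
  have X: "(\<Sum>i\<in>UNIV. cnj (X $ i $ j) * X $ i $ k) = (if j = k then 1 else 0)" for j k
  proof -
    have "(conj_transpose X ** X) $ j $ k = mat 1 $ j $ k" using assms by (simp add: SU3_def)
    thus ?thesis by (simp add: matrix_matrix_mult_def conj_transpose_def mat_def)
  qed
  have "herm (X *v v) (X *v w) = (\<Sum>i\<in>UNIV. \<Sum>j\<in>UNIV. \<Sum>k\<in>UNIV. cnj (v $ j) * w $ k * (cnj (X $ i $ j) * X $ i $ k))"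
    unfolding herm_def matrix_vector_mult_def vec_lambda_beta cnj_sum sum_product
    by (intro sum.cong refl) (simp add: mult_ac)
  also have "\<dots> = (\<Sum>j\<in>UNIV. \<Sum>i\<in>UNIV. \<Sum>k\<in>UNIV. cnj (v $ j) * w $ k * (cnj (X $ i $ j) * X $ i $ k))"
    by (rule sum.swap)
  also have "\<dots> = (\<Sum>j\<in>UNIV. \<Sum>k\<in>UNIV. cnj (v $ j) * w $ k * (\<Sum>i\<in>UNIV. cnj (X $ i $ j) * X $ i $ k))"
    unfolding sum_distrib_left by (rule sum.cong[OF refl], rule sum.swap)
  also have "\<dots> = herm v w"
    unfolding X herm_def by (simp add: if_distrib[of "\<lambda>x. _ * x"] cong: if_cong)
  finally show ?thesis .
qed

lemma SU3_mult:
  assumes "X \<in> SU3" "Y \<in> SU3"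
  shows "X ** Y \<in> SU3"
proof -
  have ct: "conj_transpose (X ** Y) = conj_transpose Y ** conj_transpose X"
    unfolding conj_transpose_def matrix_matrix_mult_def by (simp add: vec_eq_iff mult.commute)
  have "conj_transpose (X ** Y) ** (X ** Y) = conj_transpose Y ** (conj_transpose X ** X) ** Y"
    unfolding ct by (simp only: matrix_mul_assoc)
  hence "conj_transpose (X ** Y) ** (X ** Y) = mat 1" using assms by (simp add: SU3_def)
  thus ?thesis using assms matrix_left_right_inverse by (auto simp: SU3_def det_mul)
qed

lemma SU3_inj:
  assumes "X \<in> SU3" "X *v v = X *v w" shows "v = w"
proof -
  have "conj_transpose X *v (X *v v) = conj_transpose X *v (X *v w)" using assms(2) by simp
  thus ?thesis using assms(1) by (simp add: matrix_vector_mul_assoc SU3_def)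
qed

text \<open>The third row comes from the conjugate cross product, which is orthogonal to both
  vectors, has norm 1 by the Lagrange identity, and makes the determinant equal to
  \<open>herm e3 e3\<close>.\<close>

lemma SU3_from_rows:
  assumes e: "herm e1 e1 = 1" "herm e2 e2 = 1" "herm e1 e2 = 0"
  obtains X where "X \<in> SU3" "\<And>v. (X *v v) $ 1 = herm e1 v" "\<And>v. (X *v v) $ 2 = herm e2 v"
proof -
  define e3 :: "complex^3" where "e3 = vector [cnj (e1 $ 2 * e2 $ 3 - e1 $ 3 * e2 $ 2),
    cnj (e1 $ 3 * e2 $ 1 - e1 $ 1 * e2 $ 3), cnj (e1 $ 1 * e2 $ 2 - e1 $ 2 * e2 $ 1)]"
  have e3: "e3 $ 1 = cnj (e1 $ 2 * e2 $ 3 - e1 $ 3 * e2 $ 2)" "e3 $ 2 = cnj (e1 $ 3 * e2 $ 1 - e1 $ 1 * e2 $ 3)"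
    "e3 $ 3 = cnj (e1 $ 1 * e2 $ 2 - e1 $ 2 * e2 $ 1)" unfolding e3_def by (rule vector_3)+
  define E where "E i = (if i = 1 then e1 else if i = 2 then e2 else e3)" for i :: 3
  define X :: "complex^3^3" where "X = (\<chi> i j. cnj (E i $ j))"
  have Xv: "(X *v v) $ i = herm (E i) v" for v i
    unfolding X_def herm_def matrix_vector_mult_def by simp
  have h13: "herm e1 e3 = 0" "herm e2 e3 = 0" unfolding herm_def sum_3 e3 by (simp_all add: algebra_simps)
  have h33: "herm e3 e3 = herm e1 e1 * herm e2 e2 - herm e1 e2 * herm e2 e1"
    unfolding herm_def sum_3 e3 by (simp add: algebra_simps)
  hence h33': "herm e3 e3 = 1" using e by simp
  have h: "herm (E i) (E j) = (if i = j then 1 else 0)" for i j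
  proof -
    have "herm e2 e1 = 0" "herm e3 e1 = 0" "herm e3 e2 = 0"
      using e(3) h13 herm_commute[of e2 e1] herm_commute[of e3 e1] herm_commute[of e3 e2] by simp_all
    thus ?thesis using exhaust_3[of i] exhaust_3[of j] e h13 h33' unfolding E_def by auto
  qed
  have "(X ** conj_transpose X) $ i $ j = mat 1 $ i $ j" for i j
    using h[of i j] unfolding X_def conj_transpose_def matrix_matrix_mult_def mat_def herm_def by simp
  hence "X ** conj_transpose X = mat 1" by (simp add: vec_eq_iff)
  moreover from this have "conj_transpose X ** X = mat 1" by (simp add: matrix_left_right_inverse)
  moreover have "det X = herm e3 e3"
  proof -
    have Xe: "X $ 1 $ c = cnj (e1 $ c)" "X $ 2 $ c = cnj (e2 $ c)" "X $ 3 $ c = cnj (e3 $ c)" for c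
      unfolding X_def E_def by simp_all
    show ?thesis unfolding det_3 Xe herm_def sum_3 e3 by (simp add: algebra_simps)
  qed
  ultimately have "X \<in> SU3" unfolding SU3_def using h33' by simp
  thus ?thesis using that[of X] Xv unfolding E_def by simp
qed

text \<open>The common line is given by a Hermitian normal vector, which a unitary map carries to
  the normal vector of the image line.\<close>

definition proj_collinear :: "complex^3 \<Rightarrow> complex^3 \<Rightarrow> complex^3 \<Rightarrow> bool" where
  "proj_collinear a b c \<longleftrightarrow> (\<exists>v. v \<noteq> 0 \<and> herm v a = 0 \<and> herm v b = 0 \<and> herm v c = 0)"

lemma proj_collinearI:
  assumes "w1 \<noteq> 0 \<or> w2 \<noteq> 0 \<or> w3 \<noteq> 0" "\<And>x. x \<in> {a, b, c} \<Longrightarrow> w1 * x $ 1 + w2 * x $ 2 + w3 * x $ 3 = 0"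
  shows "proj_collinear a b c"
proof -
  define v :: "complex^3" where "v = vector [cnj w1, cnj w2, cnj w3]"
  have v: "v $ 1 = cnj w1" "v $ 2 = cnj w2" "v $ 3 = cnj w3" unfolding v_def by (rule vector_3)+
  have "v \<noteq> 0" using assms(1) v by auto
  moreover have "herm v x = w1 * x $ 1 + w2 * x $ 2 + w3 * x $ 3" for x
    unfolding herm_def sum_3 v by simp
  ultimately show ?thesis unfolding proj_collinear_def using assms(2) by auto
qed

lemma proj_collinear_SU3_iff:
  assumes X: "X \<in> SU3" and nz: "p \<noteq> 0" "q \<noteq> 0" "t \<noteq> 0"
  shows "proj_collinear (p *s (X *v a)) (q *s (X *v b)) (t *s (X *v c)) \<longleftrightarrow> proj_collinear a b c"
proof -
  have scale: "herm v (d *s w) = d * herm v w" for v w d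
    using herm_scale[of 1 v d w] by simp
  have move: "herm v (X *v w) = herm (conj_transpose X *v v) w" for v w
  proof -
    have "v = X *v (conj_transpose X *v v)" using X by (simp add: matrix_vector_mul_assoc SU3_def)
    thus ?thesis using herm_SU3[OF X] by metis
  qed
  have z1: "X *v v \<noteq> 0" if "v \<noteq> 0" for v using SU3_inj[OF X, of v 0] that by auto
  have z2: "conj_transpose X *v v \<noteq> 0" if "v \<noteq> 0" for v
  proof
    assume "conj_transpose X *v v = 0"
    hence "X *v (conj_transpose X *v v) = 0" by simp
    thus False using X that by (simp add: matrix_vector_mul_assoc SU3_def)
  qed
  show ?thesis
  proof
    assume "proj_collinear (p *s (X *v a)) (q *s (X *v b)) (t *s (X *v c))"
    thus "proj_collinear a b c" unfolding proj_collinear_def scale move using nz z2 by auto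
  next
    assume "proj_collinear a b c"
    then obtain v where v: "v \<noteq> 0" "herm v a = 0" "herm v b = 0" "herm v c = 0" unfolding proj_collinear_def by blast
    have "herm (X *v v) (X *v w) = herm v w" for w using herm_SU3[OF X] .
    thus "proj_collinear (p *s (X *v a)) (q *s (X *v b)) (t *s (X *v c))"
      unfolding proj_collinear_def scale using v z1[OF v(1)] by (intro exI[of _ "X *v v"]) simp
  qed
qed

context sic begin

text \<open>A phase \<open>t\<close> on the second representative makes the inner product -1/2. Then
  the sum has norm 1, the difference has squared norm 3, and the two are orthogonal; the sum and the
  difference divided by \<sigma> give the first two rows.\<close>

lemma standardize:
  assumes "i \<noteq> j"
  obtains X \<phi> where "X \<in> SU3" "\<And>k. \<phi> k \<noteq> 0"
    "sic_standard (\<lambda>k. \<phi> k *s (X *v z k)) i j (\<i> * complex_of_real (sqrt 3))"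
proof -
  define \<sigma> where "\<sigma> = \<i> * complex_of_real (sqrt 3)"
  have \<sigma>2: "\<sigma> * \<sigma> = - 3" unfolding \<sigma>_def by (rule i_sqrt3_sq)
  have c\<sigma>: "cnj \<sigma> = - \<sigma>" unfolding \<sigma>_def by simp
  have \<sigma>0: "\<sigma> \<noteq> 0" using \<sigma>2 by auto
  define g where "g = herm (z i) (z j)"
  have gg: "g * cnj g = 1 / 4" using equi[OF assms] herm_commute[of "z j" "z i"] unfolding g_def by simp
  hence g0: "g \<noteq> 0" by auto
  define t where "t = - 1 / (2 * g)"
  have tt: "cnj t * t = 1" using gg unfolding t_def by (simp add: field_simps)
  define a where "a = z i"
  define b where "b = t *s z j"
  have aa: "herm a a = 1" unfolding a_def by (rule unit)
  have bb: "herm b b = 1" unfolding b_def herm_scale using tt unit by simp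
  have ab: "herm a b = - 1 / 2" unfolding a_def b_def using herm_scale[of 1 "z i" t "z j"] g0
    by (simp add: g_def[symmetric] t_def)
  have ba: "herm b a = - 1 / 2" using ab herm_commute[of b a] by simp
  define e1 where "e1 = a + b"
  define e2 where "e2 = (1 / \<sigma>) *s (a + (- 1) *s b)"
  have neg: "herm v ((- 1) *s w) = - herm v w" "herm ((- 1) *s w) v = - herm w v" for v w
    using herm_scale[of 1 v "- 1" w] herm_scale[of "- 1" w 1 v] by simp_all
  have sc: "herm v (d *s w) = d * herm v w" "herm (d *s w) v = cnj d * herm w v" for v w d
    using herm_scale[of 1 v d w] herm_scale[of d w 1 v] by simp_all
  have e: "herm e1 e1 = 1" "herm e2 e2 = 1" "herm e1 e2 = 0"
    unfolding e1_def e2_def sc herm_add neg aa bb ab ba using \<sigma>2 \<sigma>0 by (simp_all add: c\<sigma> field_simps)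
  have e1a: "herm e1 a = 1 / 2" "herm e1 b = 1 / 2" "herm e2 a = \<sigma> / 2" "herm e2 b = - \<sigma> / 2"
    unfolding e1_def e2_def sc herm_add neg aa bb ab ba using \<sigma>2 \<sigma>0 by (simp_all add: c\<sigma> field_simps)
  obtain X where X: "X \<in> SU3" "\<And>v. (X *v v) $ 1 = herm e1 v" "\<And>v. (X *v v) $ 2 = herm e2 v"
    using SU3_from_rows[OF e] by blast
  \<comment> \<open>The first two coordinates already account for the unit norm, as 1/4 + 3/4 =
    1.\<close>
  have X3: "(X *v v) $ 3 = 0" if "herm v v = 1" "herm e1 v = 1 / 2" "herm e2 v = s" "cnj s * s = 3 / 4" for v s
  proof -
    have "1 = herm (X *v v) (X *v v)" using herm_SU3[OF X(1)] that(1) by simp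
    also have "\<dots> = cnj ((X *v v) $ 1) * (X *v v) $ 1 + cnj ((X *v v) $ 2) * (X *v v) $ 2 + cnj ((X *v v) $ 3) * (X *v v) $ 3"
      unfolding herm_def sum_3 ..
    also have "\<dots> = cnj (1 / 2) * (1 / 2) + cnj s * s + cnj ((X *v v) $ 3) * (X *v v) $ 3"
      unfolding X(2,3) that(2,3) ..
    finally have "cnj ((X *v v) $ 3) * (X *v v) $ 3 = 0" using that(4) by simp
    thus ?thesis by simp
  qed
  have a3: "(X *v a) $ 3 = 0" by (rule X3[OF aa e1a(1,3)]) (simp add: c\<sigma> \<sigma>2)
  have b3: "(X *v b) $ 3 = 0" by (rule X3[OF bb e1a(2,4)]) (simp add: c\<sigma> \<sigma>2)
  define \<phi> where "\<phi> k = (if k = j then t else 1)" for k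
  have \<phi>: "cnj (\<phi> k) * \<phi> k = 1" for k unfolding \<phi>_def using tt by simp
  define z' where "z' k = \<phi> k *s (X *v z k)" for k
  have z': "herm (z' k) (z' l) = cnj (\<phi> k) * \<phi> l * herm (z k) (z l)" for k l
    unfolding z'_def herm_scale herm_SU3[OF X(1)] ..
  have "sic z'"
  proof
    show "herm (z' k) (z' k) = 1" for k unfolding z' using \<phi> unit by simp
    show "herm (z' k) (z' l) * herm (z' l) (z' k) = 1 / 4" if "k \<noteq> l" for k l
    proof -
      have "herm (z' k) (z' l) * herm (z' l) (z' k)
        = (cnj (\<phi> k) * \<phi> k) * (cnj (\<phi> l) * \<phi> l) * (herm (z k) (z l) * herm (z l) (z k))"
        unfolding z' by (simp only: mult_ac)
      thus ?thesis using equi[OF that] by (simp only: \<phi>) simp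
    qed
  qed
  moreover have "z' i = X *v a" unfolding z'_def \<phi>_def a_def using assms by simp
  moreover have "z' j = X *v b" unfolding z'_def \<phi>_def b_def by (simp add: vector_scalar_commute)
  ultimately have "sic_standard z' i j \<sigma>"
    unfolding sic_standard_def sic_standard_axioms_def using X(2,3) a3 b3 e1a by (simp add: \<sigma>_def)
  moreover have "\<phi> k \<noteq> 0" for k using \<phi>[of k] by auto
  ultimately show ?thesis using that[OF X(1), of \<phi>] unfolding z'_def \<sigma>_def by blast
qed

end

lemma card_minus_two:
  assumes "i \<noteq> j" shows "card (UNIV - {i, j} :: (3 \<times> 3) set) = 7"
  using assms by (simp add: card_Diff_subset)

section \<open>Collinear triples in standard position\<close>

context sic_standard begin

lemma torus_points_minus:
  assumes "\<And>k. k \<in> K \<Longrightarrow> k \<noteq> i \<and> k \<noteq> j \<and> z k $ 2 \<noteq> 0"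
  shows "torus_points K r u"
  by unfold_locales (use assms pinched_torus(3) pair_equation in auto)

text \<open>A point with second coordinate 0 lies on \<open>w = 0\<close> together with the
  normalized pair. Otherwise equal \<open>r\<close> means a common line \<open>x = r y\<close>,
  equal \<open>u\<close> a common line \<open>w = sqrt 2 u y\<close>, and the third alternative
  gives a line through one normalized point.\<close>

lemma standard_collinear_triple:
  "\<exists>k l m. k \<noteq> l \<and> k \<noteq> m \<and> l \<noteq> m \<and> proj_collinear (z k) (z l) (z m)"
proof (cases "\<exists>k. k \<noteq> i \<and> k \<noteq> j \<and> z k $ 2 = 0")
  case True
  then obtain k where k: "k \<noteq> i" "k \<noteq> j" "z k $ 2 = 0" by blast
  hence "z k $ 3 = 0" using other_point(3)[OF k(1,2)] by simp
  hence "proj_collinear (z i) (z j) (z k)"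
    using k(3) by (intro proj_collinearI[of 0 0 1]) (auto simp: zi zj)
  thus ?thesis using k ij by metis
next
  case False
  define K where "K = UNIV - {i, j}"
  have K: "k \<noteq> i" "k \<noteq> j" "z k $ 2 \<noteq> 0" if "k \<in> K" for k using that False unfolding K_def by blast+
  interpret torus_points K r u by (rule torus_points_minus) (use K in blast)
  obtain F where F: "vanishing F" "\<exists>a b c. F a b c \<noteq> 0"
    using exists_cubic_through[of z] unfolding vanishing_def by metis
  have K7: "card K = 7" unfolding K_def by (rule card_minus_two[OF ij])
  hence "K \<noteq> {}" by force
  then obtain k0 where k0: "k0 \<in> K" by blast
  have cx: "z k $ 1 = z k $ 2 * of_real (r k)" and cw: "z k $ 3 = z k $ 2 * (of_real (sqrt 2) * u k)" if "k \<in> K" for k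
    using pinched_torus(1,2)[OF K[OF that]] by blast+
  have "(\<exists>k\<in>K. \<exists>l\<in>K. \<exists>m\<in>K. k \<noteq> l \<and> k \<noteq> m \<and> l \<noteq> m \<and> r k = r l \<and> r l = r m)
    \<or> (\<exists>k\<in>K. \<exists>l\<in>K. \<exists>m\<in>K. k \<noteq> l \<and> k \<noteq> m \<and> l \<noteq> m \<and> u k = u l \<and> u l = u m)
    \<or> (\<exists>k\<in>K. \<exists>l\<in>K. r k = 1 \<and> r l = - 1 \<and> (u k)\<^sup>2 + u k * u l + (u l)\<^sup>2 = 0)"
    using finite K7 cubic_equation(1)[OF F(1) K] cubic_equation(2)[OF F(1) K[OF k0]] cubic_nonzero[OF F]
    by (rule collinear_triple_exists)
  then  consider (R) k l m where "k \<in> K" "l \<in> K" "m \<in> K" "k \<noteq> l" "k \<noteq> m" "l \<noteq> m" "r k = r l" "r l = r m"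
    | (U) k l m where "k \<in> K" "l \<in> K" "m \<in> K" "k \<noteq> l" "k \<noteq> m" "l \<noteq> m" "u k = u l" "u l = u m"
    | (X) k l where "k \<in> K" "l \<in> K" "r k = 1" "r l = - 1" "(u k)\<^sup>2 + u k * u l + (u l)\<^sup>2 = 0"
    by blast
  thus ?thesis
  proof cases
    case R
    have "proj_collinear (z k) (z l) (z m)"
      by (rule proj_collinearI[of 1 "- of_real (r m)" 0]) (use R(7,8) cx[OF R(1)] cx[OF R(2)] cx[OF R(3)] in auto)
    thus ?thesis using R by metis
  next
    case U
    have "proj_collinear (z k) (z l) (z m)"
      by (rule proj_collinearI[of 0 "- (of_real (sqrt 2) * u m)" 1]) (use U(7,8) cw[OF U(1)] cw[OF U(2)] cw[OF U(3)] in auto)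
    thus ?thesis using U by metis
  next
    case X
    define q where "q = complex_of_real (sqrt 2)"
    have q0: "q \<noteq> 0" unfolding q_def by simp
    have uk0: "u k \<noteq> 0" using u_nz X(1) by blast
    \<comment> \<open>The quadratic form in \<open>X(5)\<close> is a quarter of the square of the
      difference plus three times the square of the sum, so it factors over \<sigma>. The vanishing
      factor selects the normalized point.\<close>
    have "(u l - u k - \<sigma> * (u k + u l)) * (u l - u k + \<sigma> * (u k + u l)) = 0"
      using X(5) \<sigma>_sq by algebra
    then obtain \<tau> n where \<tau>: "\<tau> = \<sigma> \<or> \<tau> = - \<sigma>" "u l - u k = \<tau> * (u k + u l)"
      and n: "n = i \<or> n = j" "z n $ 1 = 1 / 2" "z n $ 2 = \<tau> / 2" "z n $ 3 = 0"
      using zi zj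
      by (metis (no_types, lifting) add_eq_0_iff2 eq_iff_diff_eq_0 minus_mult_left mult_eq_0_iff minus_minus)
    have "proj_collinear (z n) (z k) (z l)"
    \<comment> \<open>The coefficients are the cross product of (1, \<tau>, 0) and (1, 1,
      \<open>q * u k\<close>), which are multiples of \<open>z n\<close> and
      \<open>z k\<close>.\<close>
    proof (rule proj_collinearI[of "\<tau> * (q * u k)" "- (q * u k)" "1 - \<tau>"])
      show "\<tau> * (q * u k) \<noteq> 0 \<or> - (q * u k) \<noteq> 0 \<or> 1 - \<tau> \<noteq> 0" using q0 uk0 by simp
      have "\<tau> * (q * u k) * z n $ 1 + - (q * u k) * z n $ 2 + (1 - \<tau>) * z n $ 3 = 0"
        unfolding n(2-4) by simp
      moreover have "\<tau> * (q * u k) * z k $ 1 + - (q * u k) * z k $ 2 + (1 - \<tau>) * z k $ 3 = 0"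
        unfolding cx[OF X(1)] cw[OF X(1)] X(3) q_def[symmetric] by (simp add: algebra_simps)
      moreover have "\<tau> * (q * u k) * z l $ 1 + - (q * u k) * z l $ 2 + (1 - \<tau>) * z l $ 3 = 0"
      proof -
        have "\<tau> * (q * u k) * (z l $ 2 * - 1) + - (q * u k) * z l $ 2 + (1 - \<tau>) * (z l $ 2 * (q * u l)) = 0"
          using \<tau>(2) by algebra
        thus ?thesis unfolding cx[OF X(2)] cw[OF X(2)] X(4) q_def[symmetric] by simp
      qed
      ultimately show "\<tau> * (q * u k) * x $ 1 + - (q * u k) * x $ 2 + (1 - \<tau>) * x $ 3 = 0" if "x \<in> {z n, z k, z l}" for x
        using that by blast
    qed
    moreover have "n \<noteq> k" "n \<noteq> l" "k \<noteq> l" using n(1) K(1,2)[OF X(1)] K(1,2)[OF X(2)] X(3,4) by auto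
    ultimately show ?thesis by metis
  qed
qed

end

lemma (in sic) collinear_triple:
  "\<exists>k l m. k \<noteq> l \<and> k \<noteq> m \<and> l \<noteq> m \<and> proj_collinear (z k) (z l) (z m)"
proof -
  have ne: "(1, 1) \<noteq> (1 :: 3, 2 :: 3)" by simp
  obtain X \<phi> where X: "X \<in> SU3" "\<And>k. \<phi> k \<noteq> 0"
    and s: "sic_standard (\<lambda>k. \<phi> k *s (X *v z k)) (1, 1) (1, 2) (\<i> * complex_of_real (sqrt 3))"
    by (rule standardize[OF ne]) (rule that)
  interpret s: sic_standard "\<lambda>k. \<phi> k *s (X *v z k)" "(1, 1)" "(1, 2)" "\<i> * complex_of_real (sqrt 3)" by (rule s)
  show ?thesis using s.standard_collinear_triple proj_collinear_SU3_iff[OF X(1)] X(2) by auto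
qed

subsection \<open>From a collinear triple to a midpoint solution\<close>

lemma proj_pt_in_circles:
  fixes v :: "complex^3"
  shows "v $ 1 = 0 \<Longrightarrow> cmod (v $ 2) = cmod (v $ 3) \<Longrightarrow> v $ 3 \<noteq> 0 \<Longrightarrow> proj_pt v \<in> C1"
    and "v $ 2 = 0 \<Longrightarrow> cmod (v $ 1) = cmod (v $ 3) \<Longrightarrow> v $ 3 \<noteq> 0 \<Longrightarrow> proj_pt v \<in> C2"
    and "v $ 3 = 0 \<Longrightarrow> cmod (v $ 1) = cmod (v $ 2) \<Longrightarrow> v $ 2 \<noteq> 0 \<Longrightarrow> proj_pt v \<in> C3"
proof -
  have v: "v = vector [v $ 1, v $ 2, v $ 3]" by (simp add: vec_eq_iff forall_3 vector_3)
  show "v $ 1 = 0 \<Longrightarrow> cmod (v $ 2) = cmod (v $ 3) \<Longrightarrow> v $ 3 \<noteq> 0 \<Longrightarrow> proj_pt v \<in> C1"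
    unfolding C1_def by (subst v) auto
  show "v $ 2 = 0 \<Longrightarrow> cmod (v $ 1) = cmod (v $ 3) \<Longrightarrow> v $ 3 \<noteq> 0 \<Longrightarrow> proj_pt v \<in> C2"
    unfolding C2_def by (subst v) auto
  show "v $ 3 = 0 \<Longrightarrow> cmod (v $ 1) = cmod (v $ 2) \<Longrightarrow> v $ 2 \<noteq> 0 \<Longrightarrow> proj_pt v \<in> C3"
    unfolding C3_def by (subst v) auto
qed

lemma proj_pt_coord_0:
  fixes v w :: "complex^3"
  assumes "proj_pt v = proj_pt w" shows "v $ i = 0 \<longleftrightarrow> w $ i = 0"
  using assms unfolding proj_pt_eq_iff by auto

lemma circles_disjoint: "C1 \<inter> C2 = {}" "C1 \<inter> C3 = {}" "C2 \<inter> C3 = {}"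
proof -
  have 1: "\<exists>v. p = proj_pt v \<and> v $ 1 = 0 \<and> v $ 2 \<noteq> 0 \<and> v $ 3 \<noteq> 0" if "p \<in> C1" for p
    using that unfolding C1_def by (force simp: vector_3)
  have 2: "\<exists>v. p = proj_pt v \<and> v $ 1 \<noteq> 0 \<and> v $ 2 = 0 \<and> v $ 3 \<noteq> 0" if "p \<in> C2" for p
    using that unfolding C2_def by (force simp: vector_3)
  have 3: "\<exists>v. p = proj_pt v \<and> v $ 1 \<noteq> 0 \<and> v $ 2 \<noteq> 0 \<and> v $ 3 = 0" if "p \<in> C3" for p
    using that unfolding C3_def by (force simp: vector_3)
  have "p \<notin> C2" "p \<notin> C3" if "p \<in> C1" for p
    using 1[OF that] 2[of p] 3[of p] proj_pt_coord_0 by metis+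
  moreover have "p \<notin> C3" if "p \<in> C2" for p
    using 2[OF that] 3[of p] proj_pt_coord_0 by metis
  ultimately show "C1 \<inter> C2 = {}" "C1 \<inter> C3 = {}" "C2 \<inter> C3 = {}" by blast+
qed

section \<open>Points on one diagonal line\<close>

context torus_points begin

text \<open>Equidistance says |1 + v| = 1 for the unit ratio v of the two \<open>u\<close>, so v is
  a primitive cube root of unity.\<close>

lemma same_line_u:
  assumes "k \<in> K" "l \<in> K" "k \<noteq> l" "r k = e" "r l = e" "e\<^sup>2 = 1"
  shows "(u k)\<^sup>2 + u k * u l + (u l)\<^sup>2 = 0"
proof -
  define v where "v = cnj (u k) * u l"
  have vv: "v * cnj v = 1"
  proof -
    have "v * cnj v = (u k * cnj (u k)) * (u l * cnj (u l))" unfolding v_def by (simp add: mult_ac)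
    thus ?thesis using unit_u assms(1,2) by simp
  qed
  have "r k * r l = 1" using assms(4-6) by (simp add: power2_eq_square)
  hence "4 * (cmod (2 + 2 * v))\<^sup>2 = 16"
    using pair[OF assms(1-3)] assms(4-6) unfolding v_def by simp
  hence "complex_of_real (4 * (cmod (2 + 2 * v))\<^sup>2) = of_real 16" by (simp only:)
  hence "4 * ((2 + 2 * v) * cnj (2 + 2 * v)) = 16"
    unfolding of_real_mult complex_norm_square by simp
  hence "16 * (1 + v + cnj v + v * cnj v) = 16" by (simp add: algebra_simps)
  moreover have "16 * (1 + v + v * v) = v * (16 * (1 + v + cnj v + v * cnj v) - 16) + (16 + 16 * v) * (1 - v * cnj v)"
    by (simp add: algebra_simps)
  ultimately have "16 * (1 + v + v * v) = 0" by (simp only: vv) simp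
  hence v0: "1 + v + v * v = 0" by (simp only: mult_eq_0_iff) simp
  have "u l = u k * v" unfolding v_def using unit_u[OF assms(1)] by (simp add: mult.assoc[symmetric])
  hence "(u k)\<^sup>2 + u k * u l + (u l)\<^sup>2 = (u k)\<^sup>2 * (1 + v + v * v)" by (simp add: power2_eq_square algebra_simps)
  thus ?thesis using v0 by simp
qed

text \<open>Subtracting two relations of \<open>same_line_u\<close> that share \<open>u a\<close>
  shows that \<open>u a\<close>, \<open>u b\<close> and any further \<open>u\<close> sum to 0, so
  only one further point is possible.\<close>

lemma card_same_line:
  assumes "e\<^sup>2 = 1" "finite K"
  shows "card {k\<in>K. r k = e} \<le> 3"
proof (rule ccontr)
  assume "\<not> ?thesis"
  hence "4 \<le> card {k\<in>K. r k = e}" by simp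
  then obtain T where T: "T \<subseteq> {k\<in>K. r k = e}" "card T = 4"
    by (rule obtain_subset_with_card_n)
  have "finite T" using T(2) card.infinite by fastforce
  obtain a where a: "a \<in> T" using T(2) by fastforce
  have "card (T - {a}) = 3" using T(2) a \<open>finite T\<close> by simp
  then obtain b c d where bcd: "T - {a} = {b, c, d}" "b \<noteq> c" "b \<noteq> d" "c \<noteq> d" by (metis card_3_iff)
  have inT: "b \<in> T" "c \<in> T" "d \<in> T" "b \<noteq> a" "c \<noteq> a" "d \<noteq> a" using bcd(1) by blast+
  have K: "k \<in> K" "r k = e" if "k \<in> T" for k using that T(1) by auto
  have eq: "(u k)\<^sup>2 + u k * u l + (u l)\<^sup>2 = 0" if "k \<in> T" "l \<in> T" "k \<noteq> l" for k l
    using same_line_u K that assms(1) by metis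
  have ne: "u k \<noteq> u l" if "k \<in> T" "l \<in> T" "k \<noteq> l" for k l
    using same_point K that by metis
  have sum0: "u a + u b + u x = 0" if "x \<in> {c, d}" for x
  proof -
    have x: "x \<in> T" "x \<noteq> a" "x \<noteq> b" using that inT bcd by auto
    have "(u b - u x) * (u a + u b + u x) = 0"
      using eq[OF a inT(1) inT(4)[symmetric]] eq[OF a x(1) x(2)[symmetric]] by algebra
    thus ?thesis using ne[OF inT(1) x(1)] x(3) by simp
  qed
  have "u c = u d" using sum0[of c] sum0[of d] by (simp add: add_eq_0_iff)
  thus False using ne[OF inT(2,3) bcd(4)] by simp
qed

end

text \<open>Carries the diagonal lines \<open>x = y\<close> and \<open>x = - y\<close> to the
  coordinate lines containing \<open>C1\<close> and \<open>C2\<close>, and preserves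
  \<open>w = 0\<close>, the line of \<open>C3\<close>.\<close>

definition rotation45 :: "complex^3^3" where
  "rotation45 = vector [vector [1 / of_real (sqrt 2), - 1 / of_real (sqrt 2), 0],
     vector [1 / of_real (sqrt 2), 1 / of_real (sqrt 2), 0], vector [0, 0, 1]]"

lemma rotation45_mult:
  "(rotation45 *v v) $ 1 = (v $ 1 - v $ 2) / of_real (sqrt 2)"
  "(rotation45 *v v) $ 2 = (v $ 1 + v $ 2) / of_real (sqrt 2)"
  "(rotation45 *v v) $ 3 = v $ 3"
  unfolding matrix_vector_mult_def rotation45_def
  by (simp_all add: sum_3 vector_3 diff_divide_distrib add_divide_distrib)

lemma rotation45_SU3: "rotation45 \<in> SU3"
proof -
  note q = of_real_sqrt2_sq
  have e: "rotation45 $ 1 $ 1 = 1 / of_real (sqrt 2)" "rotation45 $ 1 $ 2 = - 1 / of_real (sqrt 2)"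
    "rotation45 $ 1 $ 3 = 0" "rotation45 $ 2 $ 1 = 1 / of_real (sqrt 2)" "rotation45 $ 2 $ 2 = 1 / of_real (sqrt 2)"
    "rotation45 $ 2 $ 3 = 0" "rotation45 $ 3 $ 1 = 0" "rotation45 $ 3 $ 2 = 0" "rotation45 $ 3 $ 3 = 1"
    unfolding rotation45_def by (simp_all add: vector_3)
  have "(conj_transpose rotation45 ** rotation45) $ i $ j = mat 1 $ i $ j" for i j
    using exhaust_3[of i] exhaust_3[of j]
    by (auto simp: matrix_matrix_mult_def conj_transpose_def mat_def sum_3 e q)
  hence "conj_transpose rotation45 ** rotation45 = mat 1" by (simp add: vec_eq_iff)
  moreover have "det rotation45 = 1" unfolding det_3 e by (simp add: q)
  ultimately show ?thesis unfolding SU3_def by (simp add: matrix_left_right_inverse)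
qed

context sic_standard begin

text \<open>Here point \<open>k\<close> is \<open>[1, 0, 0]\<close>, so equidistance fixes the
  squared modulus of the first coordinate at 1/4; \<open>other_point\<close> gives the same value
  for the second.\<close>

lemma others_on_diagonals:
  assumes k: "k \<noteq> i" "k \<noteq> j" "z k $ 3 = 0" and l: "l \<noteq> i" "l \<noteq> j" "l \<noteq> k"
  shows "z l $ 2 \<noteq> 0" "(r l)\<^sup>2 = 1" "z l $ 2 * cnj (z l $ 2) = 1 / 4"
proof -
  have k2: "z k $ 2 = 0" using other_point(3)[OF k(1,2)] k(3) by simp
  hence k1: "z k $ 1 * cnj (z k $ 1) = 1" using other_point(1)[OF k(1,2)] by simp
  have "1 / 4 = (z k $ 1 * cnj (z k $ 1)) * (z l $ 1 * cnj (z l $ 1))"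
    using equi[OF l(3)] unfolding herm_def by (simp add: sum_3 k(3) k2 mult_ac)
  hence l1: "z l $ 1 * cnj (z l $ 1) = 1 / 4" unfolding k1 by simp
  have "z l $ 2 * cnj (z l $ 2) = ((1 / 4 + 3 * (z l $ 2 * cnj (z l $ 2))) - 1 / 4) / 3" by simp
  also have "\<dots> = 1 / 4" using other_point(1)[OF l(1,2)] unfolding l1 by simp
  finally have l2: "z l $ 2 * cnj (z l $ 2) = 1 / 4" .
  thus nz: "z l $ 2 \<noteq> 0" and "z l $ 2 * cnj (z l $ 2) = 1 / 4" by auto
  have "1 / 4 * complex_of_real ((r l)\<^sup>2 + 3) = 1"
    using pinched_torus(4)[OF l(1,2) nz] unfolding l2 .
  hence "complex_of_real ((r l)\<^sup>2 + 3) = of_real 4" by simp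
  hence "(r l)\<^sup>2 + 3 = 4" by (simp only: of_real_eq_iff)
  thus "(r l)\<^sup>2 = 1" by simp
qed

text \<open>Six points remain off \<open>w = 0\<close>, and \<open>card_same_line\<close> allows at
  most three on each diagonal, hence exactly three. After rotation their nonzero coordinates both
  have squared modulus 1/2.\<close>

lemma rotated_circles:
  assumes k: "k \<noteq> i" "k \<noteq> j" "z k $ 3 = 0"
  defines "A e \<equiv> {l. l \<notin> {i, j, k} \<and> r l = e}"
  defines "p l \<equiv> proj_pt (rotation45 *v z l)"
  shows "p ` A 1 \<subseteq> C1" "p ` A (- 1) \<subseteq> C2" "p ` {i, j, k} \<subseteq> C3"
    and "card (A 1) = 3" "card (A (- 1)) = 3" "UNIV = A 1 \<union> A (- 1) \<union> {i, j, k}"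
proof -
  define q where "q = complex_of_real (sqrt 2)"
  have q0: "q \<noteq> 0" unfolding q_def by simp
  have qq: "q * q = 2" unfolding q_def by (rule of_real_sqrt2_sq)
  have cq: "cnj q = q" unfolding q_def by simp
  note rot = rotation45_mult[folded q_def]
  have co: "z l $ 1 = z l $ 2 * of_real (r l)" "z l $ 3 * cnj (z l $ 3) = 1 / 2" "z l $ 3 \<noteq> 0" "z l $ 2 * cnj (z l $ 2) = 1 / 4"
    "(r l)\<^sup>2 = 1"
    if "l \<notin> {i, j, k}" for l
  proof -
    have l: "l \<noteq> i" "l \<noteq> j" "l \<noteq> k" using that by auto
    note o = others_on_diagonals[OF k l]
    show "z l $ 1 = z l $ 2 * of_real (r l)" by (rule pinched_torus(1)[OF l(1,2) o(1)])
    show 3: "z l $ 3 * cnj (z l $ 3) = 1 / 2" using other_point(3)[OF l(1,2)] o(3) by simp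
    thus "z l $ 3 \<noteq> 0" by auto
    show "z l $ 2 * cnj (z l $ 2) = 1 / 4" "(r l)\<^sup>2 = 1" by (rule o)+
  qed
  have diag: "cmod ((2 * z l $ 2) / q) = cmod (z l $ 3)" if "l \<notin> {i, j, k}" for l
  proof (rule cmod_eqI)
    have "(2 * z l $ 2) / q * cnj ((2 * z l $ 2) / q) = 4 * (z l $ 2 * cnj (z l $ 2)) / (q * q)" by (simp add: cq)
    thus "(2 * z l $ 2) / q * cnj ((2 * z l $ 2) / q) = z l $ 3 * cnj (z l $ 3)"
      unfolding qq co(4)[OF that] co(2)[OF that] by simp
  qed
  show "p ` A 1 \<subseteq> C1"
  proof (intro image_subsetI)
    fix l assume "l \<in> A 1"
    hence l: "l \<notin> {i, j, k}" "r l = 1" unfolding A_def by auto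
    show "p l \<in> C1" unfolding p_def
      by (rule proj_pt_in_circles(1)) (use co[OF l(1)] l(2) diag[OF l(1)] in \<open>simp_all add: rot\<close>)
  qed
  show "p ` A (- 1) \<subseteq> C2"
  proof (intro image_subsetI)
    fix l assume "l \<in> A (- 1)"
    hence l: "l \<notin> {i, j, k}" "r l = - 1" unfolding A_def by auto
    have "cmod ((- z l $ 2 - z l $ 2) / q) = cmod ((2 * z l $ 2) / q)"
      using norm_minus_cancel[of "(2 * z l $ 2) / q"] by simp
    thus "p l \<in> C2" unfolding p_def
      by (intro proj_pt_in_circles(2)) (use co[OF l(1)] l(2) diag[OF l(1)] in \<open>simp_all add: rot\<close>)
  qed
  show "p ` {i, j, k} \<subseteq> C3"
  proof -
    have k2: "z k $ 2 = 0" using other_point(3)[OF k(1,2)] k(3) by simp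
    have k1: "z k $ 1 \<noteq> 0" using other_point(1)[OF k(1,2)] k2 by auto
    \<comment> \<open>The two numbers are complex conjugates.\<close>
    have pm: "cmod ((1 / 2 - \<sigma> / 2) / q) = cmod ((1 / 2 + \<sigma> / 2) / q)"
      by (rule cmod_eqI) (simp add: cq \<sigma>_cnj field_simps)
    have "(1 + \<sigma>) * (1 - \<sigma>) = 4" using \<sigma>_sq by (simp add: algebra_simps)
    hence "1 + \<sigma> \<noteq> 0" "1 - \<sigma> \<noteq> 0" by auto
    hence nz: "1 / 2 + \<sigma> / 2 \<noteq> 0" "1 / 2 - \<sigma> / 2 \<noteq> 0"
      by (auto simp: add_divide_distrib[symmetric] diff_divide_distrib[symmetric])
    have "p i \<in> C3" unfolding p_def
      by (rule proj_pt_in_circles(3)) (use pm nz q0 in \<open>simp_all add: rot zi\<close>)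
    moreover have "p j \<in> C3" unfolding p_def
      by (rule proj_pt_in_circles(3)) (use pm nz q0 in \<open>simp_all add: rot zj\<close>)
    moreover have "p k \<in> C3" unfolding p_def
      by (rule proj_pt_in_circles(3)) (use k1 k2 k q0 in \<open>simp_all add: rot\<close>)
    ultimately show ?thesis by simp
  qed
  define L where "L = UNIV - {i, j, k}"
  interpret torus_points L r u
    by (rule torus_points_minus) (use others_on_diagonals(1)[OF k] in \<open>auto simp: L_def\<close>)
  have "A e = {l\<in>L. r l = e}" for e unfolding A_def L_def by auto
  hence le: "card (A 1) \<le> 3" "card (A (- 1)) \<le> 3"
    using card_same_line[of 1] card_same_line[of "- 1"] by simp_all
  have L: "L = A 1 \<union> A (- 1)"
    using co(5) unfolding L_def A_def by (auto simp: power2_eq_1_iff)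
  have "card L = 6" unfolding L_def using ij k(1,2) by (subst card_Diff_subset) auto
  moreover have "card L \<le> card (A 1) + card (A (- 1))" unfolding L by (rule card_Un_le)
  ultimately show "card (A 1) = 3" "card (A (- 1)) = 3" using le by linarith+
  show "UNIV = A 1 \<union> A (- 1) \<union> {i, j, k}" unfolding L[symmetric] L_def by auto
qed

end

lemma (in sic) SU3_to_circles:
  obtains X I1 I2 I3 where "X \<in> SU3"
    "\<And>k. k \<in> I1 \<Longrightarrow> proj_pt (X *v z k) \<in> C1" "\<And>k. k \<in> I2 \<Longrightarrow> proj_pt (X *v z k) \<in> C2"
    "\<And>k. k \<in> I3 \<Longrightarrow> proj_pt (X *v z k) \<in> C3"
    "card I1 = 3" "card I2 = 3" "card I3 = 3" "UNIV = I1 \<union> I2 \<union> I3"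
proof -
  obtain i j k where ijk: "i \<noteq> j" "i \<noteq> k" "j \<noteq> k" and col: "proj_collinear (z i) (z j) (z k)"
    using collinear_triple by blast
  obtain X \<phi> where X: "X \<in> SU3" "\<And>k. \<phi> k \<noteq> 0"
    and s: "sic_standard (\<lambda>k. \<phi> k *s (X *v z k)) i j (\<i> * complex_of_real (sqrt 3))"
    by (rule standardize[OF ijk(1)]) (rule that)
  define z' where "z' k = \<phi> k *s (X *v z k)" for k
  define \<sigma> where "\<sigma> = \<i> * complex_of_real (sqrt 3)"
  interpret s: sic_standard z' i j \<sigma> using s unfolding z'_def \<sigma>_def .
  have "proj_collinear (z' i) (z' j) (z' k)"
    unfolding z'_def using col proj_collinear_SU3_iff[OF X(1)] X(2) by blast
  then obtain v where v: "v \<noteq> 0" "herm v (z' i) = 0" "herm v (z' j) = 0" "herm v (z' k) = 0"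
    unfolding proj_collinear_def by blast
  \<comment> \<open>A normal vector of the line through the normalized pair has only a third
    component, so the collinear third point satisfies \<open>w = 0\<close>.\<close>
  have "cnj (v $ 1) + \<sigma> * cnj (v $ 2) = 0" "cnj (v $ 1) - \<sigma> * cnj (v $ 2) = 0"
    using v(2,3) unfolding herm_def by (simp_all add: sum_3 s.zi s.zj field_simps)
  hence "2 * cnj (v $ 1) = 0" "2 * (\<sigma> * cnj (v $ 2)) = 0" by algebra+
  hence v12: "v $ 1 = 0" "v $ 2 = 0" using s.\<sigma>_nz by simp_all
  hence "v $ 3 \<noteq> 0" using v(1) by (auto simp: vec_eq_iff forall_3)
  hence k3: "z' k $ 3 = 0" using v(4) v12 unfolding herm_def by (simp add: sum_3)
  note c = s.rotated_circles[OF ijk(2)[symmetric] ijk(3)[symmetric] k3]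
  define Y where "Y = rotation45 ** X"
  have Y: "proj_pt (Y *v z l) = proj_pt (rotation45 *v z' l)" for l
    unfolding proj_pt_eq_iff Y_def z'_def using X(2)
    by (intro exI[of _ "\<phi> l"]) (simp add: matrix_vector_mul_assoc[symmetric] vector_scalar_commute)
  show ?thesis
  proof (rule that[of Y])
    show "Y \<in> SU3" unfolding Y_def by (rule SU3_mult[OF rotation45_SU3 X(1)])
    show "UNIV = {l. l \<notin> {i, j, k} \<and> s.r l = 1} \<union> {l. l \<notin> {i, j, k} \<and> s.r l = - 1} \<union> {i, j, k}" by (rule c(6))
    show "card {i, j, k} = 3" using ijk by simp
  qed (use c(1-5) in \<open>auto simp: Y\<close>)
qed

section \<open>Transfer to an arbitrary SIC set\<close>

theorem theorem5p5:
  fixes S :: "(complex^3) set set"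
  assumes "SIC_set S"
  shows "\<exists>X\<in>SU3. midpoint_solution (proj_act X ` S)"
proof -
  obtain z :: "nat \<Rightarrow> complex^3" and \<kappa> where inj: "inj_on (\<lambda>i. proj_pt (z i)) {1..9}"
    and S: "S = (\<lambda>i. proj_pt (z i)) ` {1..9}"
    and norm1: "\<forall>i\<in>{1..9}. norm (z i) = 1"
    and \<kappa>: "0 \<le> \<kappa>" "\<kappa> < 1"
    and dist: "\<forall>i\<in>{1..9}. \<forall>j\<in>{1..9}. i \<noteq> j \<longrightarrow> (cmod (herm (z i) (z j)))\<^sup>2 = \<kappa>"
    using assms unfolding SIC_set_def by blast
  have "card (UNIV :: (3 \<times> 3) set) = card {1..9::nat}" by simp
  then obtain h where h: "bij_betw h (UNIV :: (3 \<times> 3) set) {1..9::nat}"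
    using finite_same_card_bij[of "UNIV :: (3 \<times> 3) set" "{1..9::nat}"] by auto
  have h19: "h k \<in> {1..9}" for k using h unfolding bij_betw_def by blast
  have unit': "herm (z (h k)) (z (h k)) = 1" for k unfolding herm_self using norm1 h19 by simp
  have equi': "herm (z (h k)) (z (h l)) * herm (z (h l)) (z (h k)) = of_real \<kappa>" if "k \<noteq> l" for k l
  proof -
    have "h k \<noteq> h l" using h that unfolding bij_betw_def inj_def by blast
    hence "(cmod (herm (z (h k)) (z (h l))))\<^sup>2 = \<kappa>" using dist h19 by blast
    thus ?thesis using complex_norm_square[of "herm (z (h k)) (z (h l))"] herm_commute[of "z (h l)" "z (h k)"] by simp
  qed
  have "\<kappa> = 1 / 4" using unit' equi' \<kappa> by (rule equiangular_tight(1))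
  interpret sic "\<lambda>k. z (h k)" by unfold_locales (use unit' equi' \<open>\<kappa> = 1 / 4\<close> in simp_all)
  obtain X I1 I2 I3 where X: "X \<in> SU3"
    and c: "\<And>k. k \<in> I1 \<Longrightarrow> proj_pt (X *v z (h k)) \<in> C1" "\<And>k. k \<in> I2 \<Longrightarrow> proj_pt (X *v z (h k)) \<in> C2"
    "\<And>k. k \<in> I3 \<Longrightarrow> proj_pt (X *v z (h k)) \<in> C3"
    and card: "card I1 = 3" "card I2 = 3" "card I3 = 3" and all: "UNIV = I1 \<union> I2 \<union> I3"
    by (rule SU3_to_circles) (rule that)
  define w where "w n = X *v z n" for n
  have im: "proj_act X ` S = (\<lambda>n. proj_pt (w n)) ` {1..9}"
    unfolding S image_image proj_act_proj_pt w_def ..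
  have winj: "inj_on (\<lambda>n. proj_pt (w n)) {1..9}"
  proof (rule inj_onI)
    fix m n assume mn: "m \<in> {1..9}" "n \<in> {1..9}" "proj_pt (w m) = proj_pt (w n)"
    then obtain a where a: "a \<noteq> 0" "w n = a *s w m" unfolding proj_pt_eq_iff by blast
    hence "X *v z n = X *v (a *s z m)" unfolding w_def by (simp add: vector_scalar_commute)
    hence "z n = a *s z m" by (rule SU3_inj[OF X])
    hence "proj_pt (z m) = proj_pt (z n)" using a(1) unfolding proj_pt_eq_iff by blast
    thus "m = n" using inj mn(1,2) unfolding inj_on_def by blast
  qed
  have wh: "herm (w m) (w n) = herm (z m) (z n)" for m n unfolding w_def by (rule herm_SU3[OF X])
  have wn: "norm (w n) = 1" if "n \<in> {1..9}" for n
  proof -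
    have "complex_of_real ((norm (w n))\<^sup>2) = of_real ((norm (z n))\<^sup>2)" using wh[of n n] unfolding herm_self .
    hence "(norm (w n))\<^sup>2 = (norm (z n))\<^sup>2" by (simp only: of_real_eq_iff)
    thus ?thesis using norm1 that by simp
  qed
  have "w n \<noteq> 0" if "n \<in> {1..9}" for n using wn[OF that] by auto
  hence "proj_act X ` S \<subseteq> CP2" unfolding im CP2_def by auto
  hence SIC: "SIC_set (proj_act X ` S)"
    unfolding SIC_set_def using im winj wn \<kappa> dist wh by (intro conjI exI[of _ w] exI[of _ \<kappa>]) auto
  define p where "p k = proj_pt (X *v z (h k))" for k
  have imp: "proj_act X ` S = p ` UNIV"
  proof -
    have "(\<lambda>n. proj_pt (w n)) ` {1..9} = (\<lambda>n. proj_pt (w n)) ` range h"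
      using h by (simp only: bij_betw_def)
    thus ?thesis unfolding im p_def w_def image_image .
  qed
  have pinj: "inj p"
    unfolding p_def using winj h comp_inj_on[of h UNIV "\<lambda>n. proj_pt (w n)"] unfolding bij_betw_def w_def o_def by simp
  have c': "p ` I1 \<subseteq> C1" "p ` I2 \<subseteq> C2" "p ` I3 \<subseteq> C3" using c unfolding p_def by auto
  have split: "p ` UNIV = p ` I1 \<union> p ` I2 \<union> p ` I3" unfolding all by blast
  have split_inter: "(A \<union> B \<union> D) \<inter> C1 = A" "(A \<union> B \<union> D) \<inter> C2 = B" "(A \<union> B \<union> D) \<inter> C3 = D"
    if "A \<subseteq> C1" "B \<subseteq> C2" "D \<subseteq> C3" for A B D
    using that circles_disjoint by (simp_all only: set_eq_iff subset_iff) blast+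
  \<comment> \<open>As the circles are disjoint, each meets the image only in the points of its own
    index set; injectivity of \<open>p\<close> then preserves the count.\<close>
  have "p ` UNIV \<inter> C1 = p ` I1" "p ` UNIV \<inter> C2 = p ` I2" "p ` UNIV \<inter> C3 = p ` I3"
    unfolding split using split_inter[OF c'] by blast+
  hence "card (p ` UNIV \<inter> C1) = 3" "card (p ` UNIV \<inter> C2) = 3" "card (p ` UNIV \<inter> C3) = 3"
    using card card_image[OF inj_on_subset[OF pinj subset_UNIV]] by simp_all
  moreover have "p ` UNIV \<subseteq> C1 \<union> C2 \<union> C3" unfolding split using c' by blast
  ultimately have "midpoint_solution (proj_act X ` S)"
    unfolding midpoint_solution_def using SIC unfolding imp by blast
  thus ?thesis using X by blast
qed

end
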